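(* Let $a,b\in\mathbb{R}$ with $b>a$, let $f\in AC(a,b)$, and let $0<\alpha<1$. Then, for $t\in(a,b)$, $${}^{ABC}\mathbf{D}_{a+}^{\alpha}f(t)=-\frac{B(\alpha)\,f(a^+)}{1-\alpha}\,E_\alpha\left[-\frac{\alpha\,(t-a)^\alpha}{1-\alpha}\right]+\frac{B(\alpha)}{1-\alpha}\sum_{k=0}^{\infty}\left(-\frac{\alpha}{1-\alpha}\right)^k J_{a+}^{\alpha k}f(t).$$
   Context: $AC(a,b)$ is the class of absolutely continuous functions on $(a,b)$; for such $f$ the derivative $f'$ exists almost everywhere, $f'\in L^1(a,b)$, and $f(a^+)=\lim_{t\to a^+}f(t)$. The one-parameter Mittag-Leffler function is $E_\alpha(z)=\sum_{k=0}^\infty\frac{z^k}{\Gamma(\alpha k+1)}$. The Atangana-Baleanu operator in the Caputo sense (ABC operator) of order $\alpha\in(0,1)$ is $${}^{ABC}\mathbf{D}_{a+}^{\alpha}f(t)=\frac{B(\alpha)}{1-\alpha}\int_a^t E_\alpha\left[-\frac{\alpha}{1-\alpha}(t-\tau)^\alpha\right]f'(\tau)\,d\tau,$$ where $B(\alpha)$ is a normalization constant depending on $\alpha$ with $B(0)=B(1)=1$; here it is applied to any $f\in AC(a,b)$ by this formula. The Riemann-Liouville integral of order $\sigma>0$ is $J_{a+}^{\sigma}f(t)=\frac{1}{\Gamma(\sigma)}\int_a^t f(\tau)(t-\tau)^{\sigma-1}\,d\tau$, and $J_{a+}^{0}f=f$. *)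

theory Defs
  imports "HOL-Analysis.Analysis"
begin

text \<open>Absolute continuity on a (possibly open) set, tested on finite families of non-overlapping
  compact subintervals. A pair \<open>(u, v)\<close> encodes the interval \<open>[u, v]\<close>; only the interiors have to be
  disjoint, so neighbouring intervals may share an endpoint.\<close>

definition abs_continuous_on :: "real set \<Rightarrow> (real \<Rightarrow> real) \<Rightarrow> bool" where
  "abs_continuous_on S f \<longleftrightarrow>
     (\<forall>\<epsilon>>0. \<exists>\<delta>>0. \<forall>D :: (real \<times> real) set.
        finite D \<longrightarrow>
        (\<forall>(u, v)\<in>D. u < v \<and> {u..v} \<subseteq> S) \<longrightarrow>
        disjoint_family_on (\<lambda>(u, v). {u<..<v}) D \<longrightarrow>
        (\<Sum>(u, v)\<in>D. v - u) < \<delta> \<longrightarrow>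
        (\<Sum>(u, v)\<in>D. \<bar>f v - f u\<bar>) < \<epsilon>)"

definition mittag_leffler :: "real \<Rightarrow> real \<Rightarrow> real" where
  "mittag_leffler \<alpha> z = (\<Sum>k. z ^ k / Gamma (\<alpha> * real k + 1))"

text \<open>Where \<open>f\<close> is not differentiable, \<^term>\<open>deriv f\<close> has an unspecified value; for absolutely
  continuous \<open>f\<close> this concerns a null set only. Integrating with respect to
  \<^term>\<open>lebesgue\<close>, which is complete, makes the integral independent of these values.\<close>

definition abc_derivative ::
    "(real \<Rightarrow> real) \<Rightarrow> real \<Rightarrow> real \<Rightarrow> (real \<Rightarrow> real) \<Rightarrow> real \<Rightarrow> real" where
  "abc_derivative B \<alpha> a f t =
     B \<alpha> / (1 - \<alpha>) *
     (LINT \<tau>:{a<..<t}|lebesgue.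
        mittag_leffler \<alpha> (- (\<alpha> / (1 - \<alpha>)) * (t - \<tau>) powr \<alpha>) * deriv f \<tau>)"

definition rl_integral :: "real \<Rightarrow> real \<Rightarrow> (real \<Rightarrow> real) \<Rightarrow> real \<Rightarrow> real" where
  "rl_integral a \<sigma> f t =
     (if \<sigma> = 0 then f t
      else 1 / Gamma \<sigma> * (LINT \<tau>:{a<..<t}|lebesgue. f \<tau> * (t - \<tau>) powr (\<sigma> - 1)))"

end

theory Submission
  imports Defs
begin

text \<open>Substituting the Mittag-Leffler series into the ABC operator and integrating term by term
  reduces the theorem to the integration by parts
  \<open>\<integral> (t - x)\<^sup>\<sigma> f'(x) dx = - (t - a)\<^sup>\<sigma> f(a+) + \<sigma> \<integral> (t - x)\<^sup>\<sigma>\<^sup>-\<^sup>1 f(x) dx\<close> over \<open>(a, t)\<close>,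
  with \<open>\<sigma> = \<alpha>k\<close>. This in turn follows, by Fubini, from the fundamental theorem of calculus for
  absolutely continuous functions. For the latter, \<open>f\<close> is a difference of monotone absolutely
  continuous functions; the Stieltjes measure of such a function is absolutely continuous with
  respect to Lebesgue measure, so that Radon-Nikodym gives \<open>f(x) - f(c) = \<integral> g\<close>; finally
  \<open>f' = g\<close> almost everywhere by Lebesgue's differentiation theorem, which is a consequence of the
  Henstock lemma and the Vitali covering theorem.\<close>

subsection \<open>Absolutely continuous functions\<close>

text \<open>Two obstacles shape the integration by parts. Absolute continuity holds on the open
  interval only, so \<open>f a\<close> is arbitrary; the closed-interval theory is applied to
  \<open>f\<close> redefined at \<open>a\<close> by its right limit, which is how f(a+) enters the
  formula. And for \<sigma> < 1 the kernel (t - x)^(\<sigma> - 1) is unbounded at x = t; it is still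
  nonnegative with finite integral, which is enough for Fubini. About f' only integrability is
  known, so the exchange of sum and integral needs a uniform majorant of the series: on [a, t] every
  term is largest in modulus at x = a. The boundary terms are multiples of the Mittag-Leffler terms
  at x = a and resum to the E_\<alpha> term, while Gamma(\<sigma> + 1) = \<sigma> Gamma(\<sigma>)
  turns the remaining ones into Riemann-Liouville integrals.\<close>

definition interval_family :: "real set \<Rightarrow> (real \<times> real) set \<Rightarrow> bool" where
  "interval_family S D \<longleftrightarrow> finite D \<and> (\<forall>(u, v)\<in>D. u < v \<and> {u..v} \<subseteq> S) \<and>
     disjoint_family_on (\<lambda>(u, v). {u<..<v}) D"

lemma interval_familyD:
  assumes "interval_family S D"
  shows "finite D" "\<And>u v. (u, v) \<in> D \<Longrightarrow> u < v" "\<And>u v. (u, v) \<in> D \<Longrightarrow> {u..v} \<subseteq> S"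
    "\<And>u v u' v'. (u, v) \<in> D \<Longrightarrow> (u', v') \<in> D \<Longrightarrow> (u, v) \<noteq> (u', v') \<Longrightarrow> {u<..<v} \<inter> {u'<..<v'} = {}"
  using assms unfolding interval_family_def disjoint_family_on_def by fast+

lemma interval_familyI:
  assumes "finite D" "\<And>u v. (u, v) \<in> D \<Longrightarrow> u < v" "\<And>u v. (u, v) \<in> D \<Longrightarrow> {u..v} \<subseteq> S"
    "\<And>u v u' v'. (u, v) \<in> D \<Longrightarrow> (u', v') \<in> D \<Longrightarrow> (u, v) \<noteq> (u', v') \<Longrightarrow> {u<..<v} \<inter> {u'<..<v'} = {}"
  shows "interval_family S D"
  unfolding interval_family_def disjoint_family_on_def
proof (intro conjI ballI impI)
  show "case p of (u, v) \<Rightarrow> u < v \<and> {u..v} \<subseteq> S" if "p \<in> D" for p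
    using assms(2,3) that by (cases p) auto
  show "(case m of (u, v) \<Rightarrow> {u<..<v}) \<inter> (case n of (u, v) \<Rightarrow> {u<..<v}) = {}"
    if "m \<in> D" "n \<in> D" "m \<noteq> n" for m n
    using assms(4) that by (cases m; cases n) auto
qed (fact assms(1))

lemma abs_continuous_on_iff:
  "abs_continuous_on S f \<longleftrightarrow> (\<forall>\<epsilon>>0. \<exists>\<delta>>0. \<forall>D. interval_family S D \<longrightarrow>
     (\<Sum>(u, v)\<in>D. v - u) < \<delta> \<longrightarrow> (\<Sum>(u, v)\<in>D. \<bar>f v - f u\<bar>) < \<epsilon>)"
  unfolding abs_continuous_on_def interval_family_def by (simp only: imp_conjL)

lemma abs_continuous_onD:
  assumes "abs_continuous_on S f" "\<epsilon> > 0"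
  obtains \<delta> where "\<delta> > 0"
    "\<And>D. interval_family S D \<Longrightarrow> (\<Sum>(u, v)\<in>D. v - u) < \<delta> \<Longrightarrow> (\<Sum>(u, v)\<in>D. \<bar>f v - f u\<bar>) < \<epsilon>"
  using assms unfolding abs_continuous_on_iff by blast

lemma interval_family_subset: "interval_family S D \<Longrightarrow> E \<subseteq> D \<Longrightarrow> interval_family S E"
  unfolding interval_family_def by (blast intro: finite_subset disjoint_family_on_mono)

lemma interval_family_restrict:
  assumes "interval_family S D" "E \<subseteq> D" "\<And>u v. (u, v) \<in> E \<Longrightarrow> {u..v} \<subseteq> T"
  shows "interval_family T E"
proof (rule interval_familyI)
  note E = interval_familyD[OF interval_family_subset[OF assms(1,2)]]
  show "finite E" by (fact E(1))
  show "u < v" if "(u, v) \<in> E" for u v using E(2)[OF that] .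
  show "{u..v} \<subseteq> T" if "(u, v) \<in> E" for u v using assms(3)[OF that] .
  show "{u<..<v} \<inter> {u'<..<v'} = {}" if "(u, v) \<in> E" "(u', v') \<in> E" "(u, v) \<noteq> (u', v')" for u v u' v'
    using E(4)[OF that] .
qed

lemma interval_family_mono: "interval_family S D \<Longrightarrow> S \<subseteq> T \<Longrightarrow> interval_family T D"
  unfolding interval_family_def by fast

lemma interval_family_empty [simp]: "interval_family S {}"
  by (simp add: interval_family_def disjoint_family_on_def)

lemma interval_family_single: "u < v \<Longrightarrow> {u..v} \<subseteq> S \<Longrightarrow> interval_family S {(u, v)}"
  by (simp add: interval_family_def disjoint_family_on_def)

lemma abs_continuous_on_diff:
  assumes "abs_continuous_on S f" "abs_continuous_on S g"
  shows "abs_continuous_on S (\<lambda>x. f x - g x)"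
  unfolding abs_continuous_on_iff
proof (intro allI impI)
  fix \<epsilon> :: real assume "\<epsilon> > 0"
  then have e: "\<epsilon>/2 > 0" by simp
  obtain d1 where d1: "d1 > 0" "\<And>D. interval_family S D \<Longrightarrow> (\<Sum>(u, v)\<in>D. v - u) < d1 \<Longrightarrow> (\<Sum>(u, v)\<in>D. \<bar>f v - f u\<bar>) < \<epsilon>/2"
    using abs_continuous_onD[OF assms(1) e] by metis
  obtain d2 where d2: "d2 > 0" "\<And>D. interval_family S D \<Longrightarrow> (\<Sum>(u, v)\<in>D. v - u) < d2 \<Longrightarrow> (\<Sum>(u, v)\<in>D. \<bar>g v - g u\<bar>) < \<epsilon>/2"
    using abs_continuous_onD[OF assms(2) e] by metis
  have "(\<Sum>(u, v)\<in>D. \<bar>(f v - g v) - (f u - g u)\<bar>) < \<epsilon>"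
    if "interval_family S D" "(\<Sum>(u, v)\<in>D. v - u) < min d1 d2" for D
  proof -
    have "(\<Sum>(u, v)\<in>D. \<bar>(f v - g v) - (f u - g u)\<bar>) \<le> (\<Sum>(u, v)\<in>D. \<bar>f v - f u\<bar>) + (\<Sum>(u, v)\<in>D. \<bar>g v - g u\<bar>)"
      unfolding sum.distrib[symmetric] by (intro sum_mono) (auto split: prod.splits)
    then show ?thesis using d1(2)[OF that(1)] d2(2)[OF that(1)] that(2) by linarith
  qed
  then show "\<exists>\<delta>>0. \<forall>D. interval_family S D \<longrightarrow> (\<Sum>(u, v)\<in>D. v - u) < \<delta> \<longrightarrow>
      (\<Sum>(u, v)\<in>D. \<bar>(f v - g v) - (f u - g u)\<bar>) < \<epsilon>"
    using d1(1) d2(1) by (intro exI[of _ "min d1 d2"]) auto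
qed

lemma abs_continuous_on_dist:
  assumes "abs_continuous_on S f" "is_interval S" "\<epsilon> > 0"
  obtains \<delta> where "\<delta> > 0" "\<And>x y. x \<in> S \<Longrightarrow> y \<in> S \<Longrightarrow> \<bar>x - y\<bar> < \<delta> \<Longrightarrow> \<bar>f x - f y\<bar> < \<epsilon>"
proof -
  obtain \<delta> where \<delta>: "\<delta> > 0"
    "\<And>D. interval_family S D \<Longrightarrow> (\<Sum>(u, v)\<in>D. v - u) < \<delta> \<Longrightarrow> (\<Sum>(u, v)\<in>D. \<bar>f v - f u\<bar>) < \<epsilon>"
    using abs_continuous_onD[OF assms(1,3)] by metis
  have *: "\<bar>f y - f x\<bar> < \<epsilon>" if "x \<in> S" "y \<in> S" "x < y" "y - x < \<delta>" for x y
  proof -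
    have "{x..y} \<subseteq> S"
      using assms(2) that by (meson atLeastAtMost_iff mem_is_interval_1_I subsetI)
    then show ?thesis using \<delta>(2)[OF interval_family_single] that by auto
  qed
  show thesis
  proof
    show "\<bar>f x - f y\<bar> < \<epsilon>" if "x \<in> S" "y \<in> S" "\<bar>x - y\<bar> < \<delta>" for x y
      using *[of x y] *[of y x] that \<open>\<epsilon> > 0\<close> by (cases x y rule: linorder_cases) (auto simp: abs_minus_commute)
  qed (fact \<delta>)
qed

lemma abs_continuous_on_imp_uniformly_continuous_on:
  assumes "abs_continuous_on S f" "is_interval S"
  shows "uniformly_continuous_on S f"
  unfolding uniformly_continuous_on_def dist_real_def
  by (metis abs_continuous_on_dist[OF assms])

text \<open>The open intervals are disjoint even where neighbours share an endpoint, so their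
  lengths add up to the measure of their union.\<close>

lemma interval_family_length_le_measure:
  assumes D: "interval_family S D" and T: "T \<in> lmeasurable" "\<And>u v. (u, v) \<in> D \<Longrightarrow> {u<..<v} \<subseteq> T"
  shows "(\<Sum>(u, v)\<in>D. v - u) \<le> measure lebesgue T"
proof -
  note D' = interval_familyD[OF D]
  have "(\<Sum>(u, v)\<in>D. v - u) = (\<Sum>p\<in>D. measure lebesgue (case p of (u, v) \<Rightarrow> {u<..<v}))"
    by (intro sum.cong refl) (auto dest!: D'(2) split: prod.splits)
  also have "\<dots> = measure lebesgue (\<Union>p\<in>D. (case p of (u, v) \<Rightarrow> {u<..<v}))"
    using D by (intro measure_finite_Union[symmetric])
      (auto simp: interval_family_def dest!: D'(2) split: prod.splits)
  also have "\<dots> \<le> measure lebesgue T"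
  proof (rule measure_mono_fmeasurable)
    show "(\<Union>p\<in>D. (case p of (u, v) \<Rightarrow> {u<..<v})) \<subseteq> T"
      using T(2) by (auto split: prod.splits)
    show "(\<Union>p\<in>D. (case p of (u, v) \<Rightarrow> {u<..<v})) \<in> sets lebesgue"
      using D'(1) by (intro sets.finite_UN) (auto split: prod.splits)
  qed (fact T(1))
  finally show ?thesis .
qed

lemma interval_family_length_le:
  assumes "interval_family {x..y} D" "x \<le> y"
  shows "(\<Sum>(u, v)\<in>D. v - u) \<le> y - x"
proof -
  have "{u<..<v} \<subseteq> {x..y}" if "(u, v) \<in> D" for u v
    using interval_familyD(3)[OF assms(1) that] greaterThanLessThan_subseteq_atLeastAtMost_iff[of u v u v]
    by (meson order_refl order_trans)
  then show ?thesis
    using interval_family_length_le_measure[OF assms(1), of "{x..y}"] assms(2) by simp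
qed

section \<open>Cutting and refining interval families\<close>

text \<open>Two different members straddling \<open>m\<close> would overlap at \<open>m\<close>, so
  at most one has to be cut. The increments are signed, so cutting preserves their sum exactly; with
  absolute values the sum could grow.\<close>

lemma interval_family_split:
  fixes f :: "real \<Rightarrow> real"
  assumes D: "interval_family {x..y} D"
  obtains D1 D2 where "interval_family {x..m} D1" "interval_family {m..y} D2"
    "(\<Sum>(u, v)\<in>D. f v - f u) = (\<Sum>(u, v)\<in>D1. f v - f u) + (\<Sum>(u, v)\<in>D2. f v - f u)"
proof -
  note D' = interval_familyD[OF D]
  define A where "A = {p \<in> D. snd p \<le> m}"
  define B where "B = {p \<in> D. m \<le> fst p}"
  define C where "C = {p \<in> D. fst p < m \<and> m < snd p}"
  have fin: "finite A" "finite B" "finite C" using D'(1) by (auto simp: A_def B_def C_def)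
  have disj: "A \<inter> B = {}" "A \<inter> C = {}" "B \<inter> C = {}"
    using D'(2) by (force simp: A_def B_def C_def)+
  have "D = A \<union> B \<union> C" by (auto simp: A_def B_def C_def)
  then have sum: "(\<Sum>(u, v)\<in>D. f v - f u) = (\<Sum>(u, v)\<in>A. f v - f u) + (\<Sum>(u, v)\<in>B. f v - f u) + (\<Sum>(u, v)\<in>C. f v - f u)"
    using fin disj by (simp add: sum.union_disjoint Int_Un_distrib2)
  have bnd: "x \<le> u \<and> v \<le> y \<and> u < v" if "(u, v) \<in> D" for u v
    using D'(2,3)[OF that] by auto
  have A: "interval_family {x..m} A"
    by (rule interval_family_restrict[OF D]) (auto simp: A_def dest: bnd)
  have B: "interval_family {m..y} B"
    by (rule interval_family_restrict[OF D]) (auto simp: B_def dest: bnd)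
  show thesis
  proof (cases "C = {}")
    case True
    then show thesis using that[OF A B] sum by simp
  next
    case False
    then obtain u v where uv: "(u, v) \<in> C" by auto
    then have uvD: "(u, v) \<in> D" "u < m" "m < v" by (auto simp: C_def)
    have "p = (u, v)" if "p \<in> C" for p
    proof (rule ccontr)
      assume ne: "p \<noteq> (u, v)"
      obtain u' v' where p: "p = (u', v')" by (cases p)
      have "m \<in> {u<..<v} \<inter> {u'<..<v'}" using that uvD p by (auto simp: C_def)
      moreover have "{u<..<v} \<inter> {u'<..<v'} = {}"
        using D'(4)[OF uvD(1), of u' v'] that ne p by (auto simp: C_def)
      ultimately show False by blast
    qed
    with uv have C: "C = {(u, v)}" by blast
    have dA: "{u<..<v} \<inter> {u'<..<v'} = {}" if "(u', v') \<in> A \<union> B" for u' v'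
    proof (rule D'(4)[OF uvD(1)])
      show "(u', v') \<in> D" using that by (auto simp: A_def B_def)
      show "(u, v) \<noteq> (u', v')" using that uv disj by blast
    qed
    have sub: "x \<le> u" "v \<le> y" using D'(3)[OF uvD(1)] uvD by auto
    have 1: "interval_family {x..m} (insert (u, m) A)"
    proof (rule interval_familyI)
      fix u1 v1 u2 v2
      assume *: "(u1, v1) \<in> insert (u, m) A" "(u2, v2) \<in> insert (u, m) A" "(u1, v1) \<noteq> (u2, v2)"
      have "{u<..<m} \<inter> {u'<..<v'} = {}" if "(u', v') \<in> A" for u' v'
      proof -
        have "{u<..<m} \<subseteq> {u<..<v}" using uvD by auto
        moreover have "{u<..<v} \<inter> {u'<..<v'} = {}" using dA that by blast
        ultimately show ?thesis by blast
      qed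
      then show "{u1<..<v1} \<inter> {u2<..<v2} = {}"
        using * interval_familyD(4)[OF A] by (elim insertE) (simp_all only: prod.inject, blast+)
    qed (use fin uvD sub interval_familyD(2,3)[OF A] in auto)
    have 2: "interval_family {m..y} (insert (m, v) B)"
    proof (rule interval_familyI)
      fix u1 v1 u2 v2
      assume *: "(u1, v1) \<in> insert (m, v) B" "(u2, v2) \<in> insert (m, v) B" "(u1, v1) \<noteq> (u2, v2)"
      have "{m<..<v} \<inter> {u'<..<v'} = {}" if "(u', v') \<in> B" for u' v'
      proof -
        have "{m<..<v} \<subseteq> {u<..<v}" using uvD by auto
        moreover have "{u<..<v} \<inter> {u'<..<v'} = {}" using dA that by blast
        ultimately show ?thesis by blast
      qed
      then show "{u1<..<v1} \<inter> {u2<..<v2} = {}"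
        using * interval_familyD(4)[OF B] by (elim insertE) (simp_all only: prod.inject, blast+)
    qed (use fin uvD sub interval_familyD(2,3)[OF B] in auto)
    \<comment> \<open>The two pieces must be new, since otherwise \<open>insert\<close> would not
      add their increments to the sums.\<close>
    have "(u, m) \<notin> A" using dA[of u m] uvD by auto
    moreover have "(m, v) \<notin> B" using dA[of m v] uvD by auto
    ultimately show thesis using that[OF 1 2] sum fin by (simp add: C)
  qed
qed

text \<open>Each member is refined by a family of its own. Pieces of different members have disjoint
  nonempty interiors and so never coincide; hence the union loses no summand.\<close>

lemma interval_family_UN:
  fixes h :: "real \<times> real \<Rightarrow> real"
  assumes D: "interval_family S D"
    and E: "\<And>u v. (u, v) \<in> D \<Longrightarrow> interval_family {u..v} (E (u, v))"
  shows "interval_family S (\<Union>p\<in>D. E p)" "sum h (\<Union>p\<in>D. E p) = (\<Sum>p\<in>D. sum h (E p))"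
proof -
  note D' = interval_familyD[OF D]
  have finE: "finite (E p)" if "p \<in> D" for p
    using interval_familyD(1)[OF E[of "fst p" "snd p"]] that by simp
  have sub: "u' < v' \<and> u \<le> u' \<and> v' \<le> v" if "(u', v') \<in> E (u, v)" "(u, v) \<in> D" for u v u' v'
    using interval_familyD(2,3)[OF E[OF that(2)] that(1)] by auto
  have disj: "{u1<..<v1} \<inter> {u2<..<v2} = {}"
    if "(u1, v1) \<in> E (u, v)" "(u, v) \<in> D" "(u2, v2) \<in> E (u', v')" "(u', v') \<in> D" "(u, v) \<noteq> (u', v')"
    for u v u' v' u1 v1 u2 v2
  proof -
    have "{u<..<v} \<inter> {u'<..<v'} = {}" using D'(4) that by blast
    moreover have "{u1<..<v1} \<subseteq> {u<..<v}" "{u2<..<v2} \<subseteq> {u'<..<v'}"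
      using sub[OF that(1,2)] sub[OF that(3,4)] by auto
    ultimately show ?thesis by blast
  qed
  show "interval_family S (\<Union>p\<in>D. E p)"
  proof (rule interval_familyI)
    show "finite (\<Union>p\<in>D. E p)" using D'(1) E finE by blast
    show "u < v" if mem: "(u, v) \<in> (\<Union>p\<in>D. E p)" for u v
    proof -
      obtain u' v' where *: "(u', v') \<in> D" "(u, v) \<in> E (u', v')" using mem by auto
      show ?thesis using sub[OF *(2,1)] by simp
    qed
    show "{u..v} \<subseteq> S" if mem: "(u, v) \<in> (\<Union>p\<in>D. E p)" for u v
    proof -
      obtain u' v' where *: "(u', v') \<in> D" "(u, v) \<in> E (u', v')" using mem by auto
      show ?thesis using D'(3)[OF *(1)] sub[OF *(2,1)] by auto
    qed
    fix u1 v1 u2 v2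
    assume *: "(u1, v1) \<in> (\<Union>p\<in>D. E p)" "(u2, v2) \<in> (\<Union>p\<in>D. E p)" "(u1, v1) \<noteq> (u2, v2)"
    then obtain u v u' v' where **: "(u, v) \<in> D" "(u1, v1) \<in> E (u, v)" "(u', v') \<in> D" "(u2, v2) \<in> E (u', v')"
      by auto
    show "{u1<..<v1} \<inter> {u2<..<v2} = {}"
    proof (cases "(u, v) = (u', v')")
      case True
      then show ?thesis using interval_familyD(4)[OF E[OF **(1)] **(2) _ *(3)] ** by auto
    next
      case False
      then show ?thesis using disj ** by blast
    qed
  qed
  show "sum h (\<Union>p\<in>D. E p) = (\<Sum>p\<in>D. sum h (E p))"
  proof (rule sum.UNION_disjoint)
    show "\<forall>p\<in>D. finite (E p)" using finE by blast
    show "\<forall>p\<in>D. \<forall>q\<in>D. p \<noteq> q \<longrightarrow> E p \<inter> E q = {}"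
    proof (intro ballI impI)
      fix p q assume *: "p \<in> D" "q \<in> D" "p \<noteq> q"
      show "E p \<inter> E q = {}"
      proof (rule ccontr)
        assume "E p \<inter> E q \<noteq> {}"
        then obtain u v where "(u, v) \<in> E p" "(u, v) \<in> E q" by auto
        then have "{u<..<v} \<inter> {u<..<v} = {}"
          using * by (intro disj[of u v "fst p" "snd p" u v "fst q" "snd q"]) (simp_all add: prod_eq_iff)
        moreover have "u < v"
          using sub[of u v "fst p" "snd p"] * \<open>(u, v) \<in> E p\<close> by simp
        ultimately show False by simp
      qed
    qed
  qed (fact D'(1))
qed

section \<open>Positive variation and the Jordan decomposition\<close>

text \<open>On pieces shorter than the \<delta> belonging to \<epsilon> = 1 the sums are at most 1,
  and finitely many such pieces make up the interval. The bound is what makes the supremum in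
  \<open>pos_var\<close> meaningful.\<close>

lemma abs_continuous_on_sum_bounded:
  assumes f: "abs_continuous_on {c..d} f"
  obtains M where "\<And>D. interval_family {c..d} D \<Longrightarrow> (\<Sum>(u, v)\<in>D. f v - f u) \<le> M"
proof -
  obtain \<delta> where \<delta>: "\<delta> > 0"
    "\<And>D. interval_family {c..d} D \<Longrightarrow> (\<Sum>(u, v)\<in>D. v - u) < \<delta> \<Longrightarrow> (\<Sum>(u, v)\<in>D. \<bar>f v - f u\<bar>) < 1"
    using abs_continuous_onD[OF f zero_less_one] by metis
  have short: "(\<Sum>(u, v)\<in>D. f v - f u) \<le> 1"
    if D: "interval_family {x..y} D" and "c \<le> x" "x \<le> y" "y \<le> d" "y - x < \<delta>" for x y D
  proof -
    have "(\<Sum>(u, v)\<in>D. f v - f u) \<le> (\<Sum>(u, v)\<in>D. \<bar>f v - f u\<bar>)"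
      by (intro sum_mono) (auto split: prod.splits)
    also have "\<dots> < 1"
    proof (rule \<delta>(2))
      show "interval_family {c..d} D"
        using that by (intro interval_family_mono[OF D]) auto
      show "(\<Sum>(u, v)\<in>D. v - u) < \<delta>"
        using interval_family_length_le[OF D] that by linarith
    qed
    finally show ?thesis by simp
  qed
  \<comment> \<open>Induction on the number of steps of length \<delta>/2 leading from
    \<open>x\<close> to \<open>d\<close>; half of \<delta> keeps each step strictly shorter than
    \<delta>.\<close>
  have "\<exists>M. \<forall>D. interval_family {x..d} D \<longrightarrow> (\<Sum>(u, v)\<in>D. f v - f u) \<le> M"
    if "c \<le> x" "x \<le> d" "d - x \<le> real n * (\<delta>/2)" for n x
    using that
  proof (induction n arbitrary: x)
    case 0
    then show ?case using short[of x d] \<delta>(1) by (intro exI[of _ 1]) auto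
  next
    case (Suc n)
    define m where "m = min d (x + \<delta>/2)"
    have m: "c \<le> m" "m \<le> d" "x \<le> m" "m - x < \<delta>" "d - m \<le> real n * (\<delta>/2)"
      using Suc.prems \<delta>(1) by (auto simp: m_def min_def algebra_simps)
    obtain M where M: "\<And>D. interval_family {m..d} D \<Longrightarrow> (\<Sum>(u, v)\<in>D. f v - f u) \<le> M"
      using Suc.IH[OF m(1,2,5)] by blast
    have "(\<Sum>(u, v)\<in>D. f v - f u) \<le> 1 + M" if D: "interval_family {x..d} D" for D
    proof -
      obtain D1 D2 where "interval_family {x..m} D1" "interval_family {m..d} D2"
        "(\<Sum>(u, v)\<in>D. f v - f u) = (\<Sum>(u, v)\<in>D1. f v - f u) + (\<Sum>(u, v)\<in>D2. f v - f u)"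
        by (rule interval_family_split[OF D, of m f])
      then show ?thesis
        using M[of D2] short[of x m D1] m Suc.prems by linarith
    qed
    then show ?case by blast
  qed
  note * = this
  show thesis
  proof (cases "c \<le> d")
    case True
    obtain n where "(d - c) / (\<delta>/2) \<le> real n" using real_arch_simple by blast
    then have "d - c \<le> real n * (\<delta>/2)" using \<delta>(1) by (simp add: field_simps)
    then show thesis using *[of c n] True that by auto
  next
    case False
    have "D = {}" if D: "interval_family {c..d} D" for D
    proof -
      have "(u, v) \<notin> D" for u v
        using interval_familyD(2,3)[OF D, of u v] False by auto
      then show ?thesis by auto
    qed
    then show thesis using that[of 0] by fastforce
  qed
qed

text \<open>Families need not cover {x..y}, so intervals on which \<open>f\<close> falls can be left
  out: this is the positive variation although the increments are signed.\<close>

definition pos_var :: "(real \<Rightarrow> real) \<Rightarrow> real \<Rightarrow> real \<Rightarrow> real" where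
  "pos_var f x y = (SUP D\<in>{D. interval_family {x..y} D}. \<Sum>(u, v)\<in>D. f v - f u)"

context
  fixes f :: "real \<Rightarrow> real" and c d :: real
  assumes ac: "abs_continuous_on {c..d} f"
begin

lemma pos_var_upper:
  assumes "interval_family {x..y} D" "c \<le> x" "y \<le> d"
  shows "(\<Sum>(u, v)\<in>D. f v - f u) \<le> pos_var f x y"
proof -
  obtain M where M: "\<And>D. interval_family {c..d} D \<Longrightarrow> (\<Sum>(u, v)\<in>D. f v - f u) \<le> M"
    by (rule abs_continuous_on_sum_bounded[OF ac]) blast
  have "interval_family {c..d} E" if "interval_family {x..y} E" for E
    using assms by (intro interval_family_mono[OF that]) auto
  then show ?thesis
    unfolding pos_var_def using assms(1) M
    by (intro cSUP_upper bdd_aboveI2[of _ _ M]) auto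
qed

lemma pos_var_least:
  assumes "\<And>D. interval_family {x..y} D \<Longrightarrow> (\<Sum>(u, v)\<in>D. f v - f u) \<le> M"
  shows "pos_var f x y \<le> M"
  unfolding pos_var_def
  by (rule cSUP_least) (use assms interval_family_empty in blast)+

lemma pos_var_subadditive:
  assumes "c \<le> x" "x \<le> y" "y \<le> d"
  shows "pos_var f c y \<le> pos_var f c x + pos_var f x y"
proof (rule pos_var_least)
  fix D assume D: "interval_family {c..y} D"
  obtain D1 D2 where "interval_family {c..x} D1" "interval_family {x..y} D2"
    "(\<Sum>(u, v)\<in>D. f v - f u) = (\<Sum>(u, v)\<in>D1. f v - f u) + (\<Sum>(u, v)\<in>D2. f v - f u)"
    by (rule interval_family_split[OF D, of x f])
  then show "(\<Sum>(u, v)\<in>D. f v - f u) \<le> pos_var f c x + pos_var f x y"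
    using pos_var_upper[of c x D1] pos_var_upper[of x y D2] assms by linarith
qed

text \<open>Appending [x, y] to a family in [c, x] gains \<open>f y - f x\<close>. This is the
  monotonicity of \<open>\<lambda>x. pos_var f c x - f x\<close>, the subtracted part of the
  decomposition.\<close>

lemma pos_var_increment:
  assumes "c \<le> x" "x \<le> y" "y \<le> d"
  shows "pos_var f c x + (f y - f x) \<le> pos_var f c y"
proof (cases "x = y")
  case False
  with assms have "x < y" by simp
  have "pos_var f c x \<le> pos_var f c y - (f y - f x)"
  proof (rule pos_var_least)
    fix D assume D: "interval_family {c..x} D"
    note D' = interval_familyD[OF D]
    have le: "v \<le> x" if "(u, v) \<in> D" for u v
      using D'(2,3)[OF that] by auto
    have "interval_family {c..y} (insert (x, y) D)"
    proof (rule interval_familyI)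
      fix u v u' v'
      assume *: "(u, v) \<in> insert (x, y) D" "(u', v') \<in> insert (x, y) D" "(u, v) \<noteq> (u', v')"
      show "{u<..<v} \<inter> {u'<..<v'} = {}"
        using * D'(4)[of u v u' v'] le[of u v] le[of u' v'] by auto
    next
      show "{u..v} \<subseteq> {c..y}" if "(u, v) \<in> insert (x, y) D" for u v
        using that D'(3)[of u v] assms by auto
    qed (use D'(1,2) \<open>x < y\<close> in auto)
    then have "(\<Sum>(u, v)\<in>insert (x, y) D. f v - f u) \<le> pos_var f c y"
      using pos_var_upper assms by simp
    moreover have "(x, y) \<notin> D" using le \<open>x < y\<close> by force
    ultimately show "(\<Sum>(u, v)\<in>D. f v - f u) \<le> pos_var f c y - (f y - f x)"
      using D'(1) by simp
  qed
  then show ?thesis by simp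
qed simp

lemma pos_var_mono:
  assumes "c \<le> x" "x \<le> y" "y \<le> d"
  shows "pos_var f c x \<le> pos_var f c y"
proof (rule pos_var_least)
  fix D assume "interval_family {c..x} D"
  then have "interval_family {c..y} D"
    using assms by (auto elim: interval_family_mono)
  then show "(\<Sum>(u, v)\<in>D. f v - f u) \<le> pos_var f c y"
    using pos_var_upper assms by simp
qed

text \<open>In each interval of a short family choose a family that nearly attains the positive
  variation. Together these form one family of no greater total length, to which the absolute
  continuity of \<open>f\<close> applies.\<close>

lemma abs_continuous_on_pos_var: "abs_continuous_on {c..d} (pos_var f c)"
  unfolding abs_continuous_on_iff
proof (intro allI impI)
  fix \<epsilon> :: real assume "\<epsilon> > 0"
  then have "\<epsilon>/3 > 0" by simp
  obtain \<delta> where \<delta>: "\<delta> > 0"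
    "\<And>D. interval_family {c..d} D \<Longrightarrow> (\<Sum>(u, v)\<in>D. v - u) < \<delta> \<Longrightarrow> (\<Sum>(u, v)\<in>D. \<bar>f v - f u\<bar>) < \<epsilon>/3"
    using abs_continuous_onD[OF ac \<open>\<epsilon>/3 > 0\<close>] by metis
  have "(\<Sum>(u, v)\<in>D. \<bar>pos_var f c v - pos_var f c u\<bar>) < \<epsilon>"
    if D: "interval_family {c..d} D" and len: "(\<Sum>(u, v)\<in>D. v - u) < \<delta>" for D
  proof -
    note D' = interval_familyD[OF D]
    \<comment> \<open>Spreads an error of \<epsilon>/3 over the members of \<open>D\<close>; the
      added 1 takes care of empty \<open>D\<close>.\<close>
    define \<eta> where "\<eta> = \<epsilon>/3 / (real (card D) + 1)"
    have "\<eta> > 0" using \<open>\<epsilon>/3 > 0\<close> by (simp add: \<eta>_def)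
    have bnd: "c \<le> u \<and> u < v \<and> v \<le> d" if "(u, v) \<in> D" for u v
      using D'(2,3)[OF that] by auto
    have "\<exists>E. interval_family {u..v} E \<and> pos_var f u v - \<eta> < (\<Sum>(u, v)\<in>E. f v - f u)" for u v
    proof (rule ccontr)
      assume "\<not> ?thesis"
      then have "pos_var f u v \<le> pos_var f u v - \<eta>"
        by (intro pos_var_least) (meson not_less)
      then show False using \<open>\<eta> > 0\<close> by simp
    qed
    then obtain E where E: "\<And>u v. interval_family {u..v} (E (u, v))"
      "\<And>u v. pos_var f u v - \<eta> < (\<Sum>(u, v)\<in>E (u, v). f v - f u)"
      by (metis (no_types) case_prod_conv)
    let ?U = "\<Union>p\<in>D. E p"
    have U: "interval_family {c..d} ?U" by (rule interval_family_UN(1)[OF D E(1)])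
    have "(\<Sum>(u, v)\<in>?U. v - u) = (\<Sum>p\<in>D. \<Sum>(u, v)\<in>E p. v - u)"
      by (rule interval_family_UN(2)[OF D E(1)])
    also have "\<dots> \<le> (\<Sum>(u, v)\<in>D. v - u)"
    proof (rule sum_mono)
      show "(\<Sum>(u, v)\<in>E p. v - u) \<le> (case p of (u, v) \<Rightarrow> v - u)" if "p \<in> D" for p
        using that interval_family_length_le[OF E(1)] bnd by (cases p) force
    qed
    finally have "(\<Sum>(u, v)\<in>?U. \<bar>f v - f u\<bar>) < \<epsilon>/3"
      using \<delta>(2)[OF U] len by linarith
    moreover have "(\<Sum>(u, v)\<in>?U. f v - f u) \<le> (\<Sum>(u, v)\<in>?U. \<bar>f v - f u\<bar>)"
      by (intro sum_mono) (auto split: prod.splits)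
    ultimately have small: "(\<Sum>p\<in>D. \<Sum>(u, v)\<in>E p. f v - f u) < \<epsilon>/3"
      using interval_family_UN(2)[OF D E(1), of "\<lambda>(u, v). f v - f u"] by simp
    have "(\<Sum>(u, v)\<in>D. \<bar>pos_var f c v - pos_var f c u\<bar>) \<le> (\<Sum>p\<in>D. (\<Sum>(u, v)\<in>E p. f v - f u) + \<eta>)"
    proof (rule sum_mono)
      fix p assume "p \<in> D"
      obtain u v where p: "p = (u, v)" by (cases p)
      with \<open>p \<in> D\<close> have uv: "c \<le> u" "u \<le> v" "v \<le> d" using bnd[of u v] by auto
      have "\<bar>pos_var f c v - pos_var f c u\<bar> \<le> pos_var f u v"
        using pos_var_subadditive[OF uv] pos_var_mono[OF uv] by simp
      also have "\<dots> \<le> (\<Sum>(u, v)\<in>E p. f v - f u) + \<eta>"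
        using E(2)[of u v] by (simp add: p)
      finally show "(case p of (u, v) \<Rightarrow> \<bar>pos_var f c v - pos_var f c u\<bar>) \<le> (\<Sum>(u, v)\<in>E p. f v - f u) + \<eta>"
        by (simp add: p)
    qed
    also have "\<dots> = (\<Sum>p\<in>D. \<Sum>(u, v)\<in>E p. f v - f u) + real (card D) * \<eta>"
      by (simp add: sum.distrib)
    also have "real (card D) * \<eta> \<le> \<epsilon>/3"
      using \<open>\<epsilon> > 0\<close> by (simp add: \<eta>_def field_simps)
    finally show ?thesis using small \<open>\<epsilon> > 0\<close> by linarith
  qed
  then show "\<exists>\<delta>>0. \<forall>D. interval_family {c..d} D \<longrightarrow> (\<Sum>(u, v)\<in>D. v - u) < \<delta> \<longrightarrow>
      (\<Sum>(u, v)\<in>D. \<bar>pos_var f c v - pos_var f c u\<bar>) < \<epsilon>"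
    using \<delta>(1) by blast
qed

end

text \<open>\<open>N\<close> is the negative variation up to an additive constant, obtained as
  \<open>P - f\<close> so that its absolute continuity comes for free.\<close>

lemma abs_continuous_on_Jordan_decomposition:
  assumes f: "abs_continuous_on {c..d} f"
  obtains P N where "abs_continuous_on {c..d} P" "abs_continuous_on {c..d} N"
    "mono_on {c..d} P" "mono_on {c..d} N" "\<And>x. f x = P x - N x"
proof
  let ?P = "pos_var f c" let ?N = "\<lambda>x. pos_var f c x - f x"
  show "abs_continuous_on {c..d} ?P" by (rule abs_continuous_on_pos_var[OF f])
  then show "abs_continuous_on {c..d} ?N" by (rule abs_continuous_on_diff[OF _ f])
  show "mono_on {c..d} ?P" by (rule mono_onI) (use pos_var_mono[OF f] in auto)
  show "mono_on {c..d} ?N" by (rule mono_onI) (use pos_var_increment[OF f] in fastforce)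
qed simp

subsection \<open>Densities of absolutely continuous functions\<close>

text \<open>A null set is covered by nonoverlapping intervals of total length below \<delta>, whose
  Stieltjes measures are increments of \<open>G\<close> and hence small in sum. Absolute continuity
  speaks of finite families, so finite subfamilies are bounded first and the bound is then carried
  over to the countable union.\<close>

lemma mono_abs_continuous_on_emeasure_null:
  fixes G :: "real \<Rightarrow> real"
  assumes ac: "abs_continuous_on {c..d} G" and mono: "mono G" and cont: "continuous_on UNIV G"
    and "c < d" and T: "T \<in> null_sets lborel" "T \<subseteq> {c..d}"
  shows "emeasure (interval_measure G) T = 0"
proof -
  let ?\<mu> = "interval_measure G"
  \<comment> \<open>Continuity of \<open>G\<close> rules out an atom at the left endpoint.\<close>
  have Icc: "emeasure ?\<mu> {u..v} = ennreal (G v - G u)" if "u \<le> v" for u v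
    using emeasure_interval_measure_Icc[of u v G] that mono cont by (simp add: mono_def)
  have "emeasure ?\<mu> T \<le> ennreal \<epsilon>" if "\<epsilon> > 0" for \<epsilon>
  proof -
    obtain \<delta> where \<delta>: "\<delta> > 0"
      "\<And>D. interval_family {c..d} D \<Longrightarrow> (\<Sum>(u, v)\<in>D. v - u) < \<delta> \<Longrightarrow> (\<Sum>(u, v)\<in>D. \<bar>G v - G u\<bar>) < \<epsilon>"
      using abs_continuous_onD[OF ac \<open>\<epsilon> > 0\<close>] by metis
    have "negligible T"
      using T(1) by (simp add: negligible_iff_null_sets null_sets_completionI)
    then have neg: "T \<in> lmeasurable" "measure lebesgue T = 0"
      by (auto simp: negligible_imp_measurable negligible_imp_measure0)
    \<comment> \<open>As \<open>box c d\<close> is nonempty, the fourth property excludes degenerate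
      intervals, which \<open>interval_family\<close> does not admit.\<close>
    obtain \<D> where \<D>: "countable \<D>"
      "\<And>K. K \<in> \<D> \<Longrightarrow> K \<subseteq> cbox c d \<and> K \<noteq> {} \<and> (\<exists>u v. K = cbox u v)"
      "pairwise (\<lambda>A B. interior A \<inter> interior B = {}) \<D>"
      "\<And>K. \<lbrakk>K \<in> \<D>; box c d \<noteq> {}\<rbrakk> \<Longrightarrow> interior K \<noteq> {}"
      "T \<subseteq> \<Union>\<D>" "\<Union>\<D> \<in> lmeasurable" "measure lebesgue (\<Union>\<D>) \<le> measure lebesgue T + \<delta>/2"
    proof (rule measurable_outer_intervals_bounded[of T c d "\<delta>/2"])
      show "T \<in> lmeasurable" by (fact neg)
      show "T \<subseteq> cbox c d" using T(2) by simp
      show "\<delta>/2 > 0" using \<delta>(1) by simp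
    qed blast
    define ends where "ends = (\<lambda>K :: real set. (Inf K, Sup K))"
    have K: "\<exists>u v. u < v \<and> c \<le> u \<and> v \<le> d \<and> K = {u..v} \<and> ends K = (u, v)" if K: "K \<in> \<D>" for K
    proof -
      obtain u v where uv: "K = {u..v}" using \<D>(2)[OF K] by auto
      moreover have "interior K \<noteq> {}" using \<D>(4)[OF K] \<open>c < d\<close> by simp
      ultimately have "u < v" by simp
      moreover have "K \<subseteq> {c..d}" using \<D>(2)[OF K] by simp
      ultimately show ?thesis using uv by (auto simp: ends_def)
    qed
    have fin: "emeasure ?\<mu> (\<Union>\<E>) \<le> ennreal \<epsilon>" if \<E>: "\<E> \<subseteq> \<D>" "finite \<E>" for \<E>
    proof -
      note KE = K[OF subsetD[OF \<E>(1)]]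
      have inj: "inj_on ends \<E>"
      proof (rule inj_onI)
        fix A B assume "A \<in> \<E>" "B \<in> \<E>" "ends A = ends B"
        then show "A = B" using KE[of A] KE[of B] by auto
      qed
      have endsD: "{u..v} \<in> \<E> \<and> u < v \<and> c \<le> u \<and> v \<le> d" if mem: "(u, v) \<in> ends ` \<E>" for u v
      proof -
        obtain A where A: "A \<in> \<E>" "(u, v) = ends A" using mem by blast
        moreover obtain u' v' where "u' < v'" "c \<le> u'" "v' \<le> d" "A = {u'..v'}" "ends A = (u', v')"
          using KE[OF A(1)] by blast
        ultimately show ?thesis by simp
      qed
      have fam: "interval_family {c..d} (ends ` \<E>)"
      proof (rule interval_familyI)
        show "finite (ends ` \<E>)" using \<E>(2) by simp
        show "u < v" "{u..v} \<subseteq> {c..d}" if mem: "(u, v) \<in> ends ` \<E>" for u v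
          using endsD[OF mem] by auto
        fix u v u' v' assume *: "(u, v) \<in> ends ` \<E>" "(u', v') \<in> ends ` \<E>" "(u, v) \<noteq> (u', v')"
        then have "{u..v} \<in> \<D>" "{u'..v'} \<in> \<D>" "{u..v} \<noteq> {u'..v'}"
          using endsD[OF *(1)] endsD[OF *(2)] \<E>(1) by auto
        then have "interior {u..v} \<inter> interior {u'..v'} = {}"
          using \<D>(3) unfolding pairwise_def by blast
        then show "{u<..<v} \<inter> {u'<..<v'} = {}" by (simp only: interior_atLeastAtMost_real)
      qed
      have "(\<Sum>(u, v)\<in>ends ` \<E>. v - u) \<le> measure lebesgue (\<Union>\<D>)"
      proof (rule interval_family_length_le_measure[OF fam \<D>(6)])
        fix u v assume "(u, v) \<in> ends ` \<E>"
        then have "{u..v} \<in> \<D>" using endsD \<E>(1) by blast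
        moreover have "{u<..<v} \<subseteq> {u..v}" by auto
        ultimately show "{u<..<v} \<subseteq> \<Union>\<D>" by blast
      qed
      then have "(\<Sum>(u, v)\<in>ends ` \<E>. v - u) < \<delta>"
        using \<D>(7) neg(2) \<delta>(1) by linarith
      then have small: "(\<Sum>(u, v)\<in>ends ` \<E>. \<bar>G v - G u\<bar>) < \<epsilon>"
        using \<delta>(2)[OF fam] by blast
      have "emeasure ?\<mu> (\<Union>K\<in>\<E>. K) \<le> (\<Sum>K\<in>\<E>. emeasure ?\<mu> K)"
      proof (rule emeasure_subadditive_finite[OF \<E>(2)])
        have "K \<in> sets borel" if "K \<in> \<E>" for K
          using KE[OF that] by auto
        then show "(\<lambda>K. K) ` \<E> \<subseteq> sets ?\<mu>" by auto
      qed
      also have "\<dots> = (\<Sum>K\<in>\<E>. ennreal \<bar>G (Sup K) - G (Inf K)\<bar>)"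
      proof (rule sum.cong)
        fix K assume "K \<in> \<E>"
        then obtain u v where "u < v" "K = {u..v}" using KE[of K] by blast
        then show "emeasure ?\<mu> K = ennreal \<bar>G (Sup K) - G (Inf K)\<bar>"
          using Icc[of u v] monoD[OF mono, of u v] by simp
      qed simp
      also have "\<dots> = ennreal (\<Sum>K\<in>\<E>. \<bar>G (Sup K) - G (Inf K)\<bar>)"
        by (intro sum_ennreal) auto
      also have "(\<Sum>K\<in>\<E>. \<bar>G (Sup K) - G (Inf K)\<bar>) = (\<Sum>(u, v)\<in>ends ` \<E>. \<bar>G v - G u\<bar>)"
        unfolding sum.reindex[OF inj] by (simp add: ends_def)
      also have "ennreal \<dots> \<le> ennreal \<epsilon>" using small by (intro ennreal_leI) simp
      finally show ?thesis by simp
    qed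
    have \<D>_meas: "K \<in> fmeasurable ?\<mu>" if K_mem: "K \<in> \<D>" for K
    proof -
      obtain u v where "u < v" "K = {u..v}" using K[OF K_mem] by blast
      then show ?thesis using Icc[of u v] by (intro fmeasurableI) auto
    qed
    have bound: "measure ?\<mu> (\<Union>\<E>) \<le> \<epsilon>" if "\<E> \<subseteq> \<D>" "finite \<E>" for \<E>
      using fin[OF that] \<open>\<epsilon> > 0\<close> by (simp add: measure_def enn2real_leI)
    have "\<Union>\<D> \<in> fmeasurable ?\<mu>" "measure ?\<mu> (\<Union>\<D>) \<le> \<epsilon>"
      using fmeasurable_Union_bound[OF \<D>(1) \<D>_meas bound] measure_Union_bound[OF \<D>(1) \<D>_meas bound] by auto
    then have "emeasure ?\<mu> (\<Union>\<D>) \<le> ennreal \<epsilon>"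
      by (simp add: emeasure_eq_measure2 ennreal_leI)
    moreover have "emeasure ?\<mu> T \<le> emeasure ?\<mu> (\<Union>\<D>)"
      using \<D>(5) \<open>\<Union>\<D> \<in> fmeasurable ?\<mu>\<close> by (intro emeasure_mono) (auto dest: fmeasurableD)
    ultimately show ?thesis by (rule order_trans[rotated])
  qed
  then show ?thesis
    by (metis ennreal_le_epsilon add.left_neutral le_zero_eq)
qed

lemma mono_abs_continuous_on_density:
  assumes ac: "abs_continuous_on {c..d} F" and mono: "mono_on {c..d} F" and "c < d"
  obtains g :: "real \<Rightarrow> real" where "integrable lborel g"
    "\<And>x. x \<in> {c..d} \<Longrightarrow> (LINT y:{c..x}|lborel. g y) = F x - F c"
proof -
  \<comment> \<open>\<^const>\<open>interval_measure\<close> needs a function that is monotone and continuous on the whole line.\<close>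
  define G where "G = (\<lambda>x. F (max c (min d x)))"
  have GF: "G x = F x" if "x \<in> {c..d}" for x using that by (simp add: G_def)
  have "mono G"
    using \<open>c < d\<close> unfolding G_def by (intro monoI mono_onD[OF mono]) auto
  have contF: "continuous_on {c..d} F"
    by (rule uniformly_continuous_imp_continuous[OF abs_continuous_on_imp_uniformly_continuous_on[OF ac is_interval_cc]])
  have "continuous_on UNIV G"
    unfolding G_def
  proof (rule continuous_on_compose2[OF contF])
    show "continuous_on UNIV (\<lambda>x. max c (min d x))" by (intro continuous_intros)
  qed (use \<open>c < d\<close> in auto)
  have "abs_continuous_on {c..d} G"
  proof -
    have "(\<Sum>(u, v)\<in>D. \<bar>G v - G u\<bar>) = (\<Sum>(u, v)\<in>D. \<bar>F v - F u\<bar>)" if D: "interval_family {c..d} D" for D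
    proof (intro sum.cong refl, clarify)
      fix u v assume "(u, v) \<in> D"
      then show "\<bar>G v - G u\<bar> = \<bar>F v - F u\<bar>"
        using interval_familyD(2,3)[OF D, of u v] GF[of u] GF[of v] by auto
    qed
    then show ?thesis using ac unfolding abs_continuous_on_iff by auto
  qed
  let ?\<mu> = "interval_measure G"
  \<comment> \<open>Restricting to {c..d} leaves only null subsets of {c..d} to consider, as
    \<open>mono_abs_continuous_on_emeasure_null\<close> requires.\<close>
  define N where "N = density ?\<mu> (indicator {c..d})"
  have N: "emeasure N S = emeasure ?\<mu> ({c..d} \<inter> S)" if "S \<in> sets borel" for S
    using that by (simp add: N_def emeasure_density indicator_inter_arith[symmetric])
  have "absolutely_continuous lborel N"
    unfolding absolutely_continuous_def
  proof
    fix S :: "real set" assume S: "S \<in> null_sets lborel"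
    then have "S \<in> sets borel" by auto
    then have "{c..d} \<inter> S \<in> null_sets lborel" using S by (intro null_set_Int1) auto
    then have "emeasure ?\<mu> ({c..d} \<inter> S) = 0"
      by (intro mono_abs_continuous_on_emeasure_null[OF \<open>abs_continuous_on {c..d} G\<close> \<open>mono G\<close> \<open>continuous_on UNIV G\<close> \<open>c < d\<close>]) auto
    then show "S \<in> null_sets N"
      using N[OF \<open>S \<in> sets borel\<close>] \<open>S \<in> sets borel\<close> by (auto simp: N_def)
  qed
  then obtain h where h: "h \<in> borel_measurable lborel" "density lborel h = N"
    using sigma_finite_measure.Radon_Nikodym[OF sigma_finite_lborel, of N] by (auto simp: N_def)
  have [measurable]: "h \<in> borel_measurable borel" using h(1) by simp
  have Icc: "emeasure ?\<mu> {u..v} = ennreal (G v - G u)" if "u \<le> v" for u v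
    using emeasure_interval_measure_Icc[of u v G] that \<open>mono G\<close> \<open>continuous_on UNIV G\<close> by (simp add: mono_def)
  have int: "(\<integral>\<^sup>+y. h y * indicator {c..x} y \<partial>lborel) = ennreal (F x - F c)" if "x \<in> {c..d}" for x
  proof -
    have "(\<integral>\<^sup>+y. h y * indicator {c..x} y \<partial>lborel) = emeasure (density lborel h) {c..x}"
      by (simp add: emeasure_density)
    also have "\<dots> = emeasure ?\<mu> ({c..d} \<inter> {c..x})" unfolding h(2) by (rule N) simp
    also have "{c..d} \<inter> {c..x} = {c..x}" using that by auto
    finally show ?thesis using that Icc[of c x] GF[of c] GF[of x] by simp
  qed
  have "(\<integral>\<^sup>+y. h y \<partial>lborel) = emeasure (density lborel h) UNIV"
    by (simp add: emeasure_density)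
  also have "\<dots> < \<infinity>"
    unfolding h(2) using \<open>c < d\<close> by (simp add: N Icc)
  finally have fin: "(\<integral>\<^sup>+y. h y \<partial>lborel) < \<infinity>" .
  then have "AE y in lborel. h y \<noteq> \<infinity>"
    by (intro nn_integral_PInf_AE) auto
  \<comment> \<open>\<open>N\<close> has finite total mass, so \<open>h\<close> is infinite on a
    null set only; there \<open>enn2real\<close> gives 0.\<close>
  define g where "g = (\<lambda>y. enn2real (h y))"
  have gh: "AE y in lborel. ennreal (g y) = h y"
    using \<open>AE y in lborel. h y \<noteq> \<infinity>\<close> by eventually_elim (simp add: g_def less_top)
  have g: "integrable lborel g"
  proof (rule integrableI_bounded)
    show "g \<in> borel_measurable lborel" unfolding g_def by simp
    have "(\<integral>\<^sup>+y. ennreal (norm (g y)) \<partial>lborel) = (\<integral>\<^sup>+y. h y \<partial>lborel)"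
      using gh by (intro nn_integral_cong_AE) (auto simp: g_def)
    then show "(\<integral>\<^sup>+y. ennreal (norm (g y)) \<partial>lborel) < \<infinity>" using fin by simp
  qed
  show thesis
  proof (rule that[OF g])
    fix x assume x: "x \<in> {c..d}"
    have "(\<integral>\<^sup>+y. ennreal (indicator {c..x} y *\<^sub>R g y) \<partial>lborel) = (\<integral>\<^sup>+y. h y * indicator {c..x} y \<partial>lborel)"
      using gh by (intro nn_integral_cong_AE, eventually_elim) (auto simp: indicator_def)
    also have "\<dots> = ennreal (F x - F c)" by (rule int[OF x])
    finally show "(LINT y:{c..x}|lborel. g y) = F x - F c"
      unfolding set_lebesgue_integral_def
      using mono_onD[OF mono, of c x] x g
      by (subst integral_eq_nn_integral) (auto simp: g_def)
  qed
qed

lemma abs_continuous_on_density: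
  assumes ac: "abs_continuous_on {c..d} f" and "c < d"
  obtains g :: "real \<Rightarrow> real" where "integrable lborel g"
    "\<And>x. x \<in> {c..d} \<Longrightarrow> (LINT y:{c..x}|lborel. g y) = f x - f c"
proof -
  obtain P N where PN: "abs_continuous_on {c..d} P" "abs_continuous_on {c..d} N"
    "mono_on {c..d} P" "mono_on {c..d} N" "\<And>x. f x = P x - N x"
    using abs_continuous_on_Jordan_decomposition[OF ac] by blast
  obtain p where p: "integrable lborel p" "\<And>x. x \<in> {c..d} \<Longrightarrow> (LINT y:{c..x}|lborel. p y) = P x - P c"
    using mono_abs_continuous_on_density[OF PN(1,3) \<open>c < d\<close>] by blast
  obtain n where n: "integrable lborel n" "\<And>x. x \<in> {c..d} \<Longrightarrow> (LINT y:{c..x}|lborel. n y) = N x - N c"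
    using mono_abs_continuous_on_density[OF PN(2,4) \<open>c < d\<close>] by blast
  show thesis
  proof (rule that[of "\<lambda>y. p y - n y"])
    show "integrable lborel (\<lambda>y. p y - n y)" using p n by simp
    show "(LINT y:{c..x}|lborel. p y - n y) = f x - f c" if "x \<in> {c..d}" for x
    proof -
      have "set_integrable lborel {c..x} p" "set_integrable lborel {c..x} n"
        unfolding set_integrable_def by (intro integrable_mult_indicator p(1) n(1); simp)+
      then show ?thesis
        using p(2)[OF that] n(2)[OF that] PN(5)[of x] PN(5)[of c] by (simp add: set_integral_diff(2))
    qed
  qed
qed

subsection \<open>Lebesgue differentiation and the fundamental theorem\<close>

text \<open>Where the derivative fails, the point lies in some \<open>Bad n\<close>: arbitrarily
  close to it the difference quotient of the integral misses \<open>g x\<close> by at least 1/(n +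
  1). So it suffices that each of these countably many sets is null.\<close>

lemma negligible_not_has_real_derivative_integral:
  fixes g :: "real \<Rightarrow> real"
  assumes g: "g integrable_on {c..d}"
  shows "negligible {x \<in> {c<..<d}. \<not> ((\<lambda>y. integral {c..y} g) has_real_derivative g x) (at x)}"
proof -
  define G where "G = (\<lambda>y. integral {c..y} g)"
  define bad where "bad = (\<lambda>n x y. \<bar>y - x\<bar> \<le> real (Suc n) * \<bar>G y - G x - g x * (y - x)\<bar>)"
  define Bad where "Bad = (\<lambda>n. {x \<in> {c<..<d}. \<forall>h>0. \<exists>y\<in>{c..d}. y \<noteq> x \<and> \<bar>y - x\<bar> < h \<and> bad n x y})"
  have int_diff: "integral {x..y} g = G y - G x" if "c \<le> x" "x \<le> y" "y \<le> d" for x y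
  proof -
    have "g integrable_on {c..y}"
      by (rule integrable_subinterval_real[OF g]) (use that in auto)
    then show ?thesis
      using Henstock_Kurzweil_Integration.integral_combine[of c x y g] that by (simp add: G_def)
  qed
  have "negligible (Bad n)" for n
    unfolding negligible_outer_le
  proof (intro allI impI)
    fix e :: real assume "e > 0"
    then have "e / real (Suc n) > 0" by simp
    \<comment> \<open>Dividing by \<open>Suc n\<close> offsets the factor in \<open>bad\<close>,
      which bounds the length of a bad segment by \<open>Suc n\<close> times its Henstock
      error.\<close>
    obtain \<gamma> where \<gamma>: "gauge \<gamma>"
      "\<And>p. p tagged_partial_division_of (cbox c d) \<Longrightarrow> \<gamma> fine p \<Longrightarrow>
         (\<Sum>(x, k)\<in>p. norm (measure lborel k *\<^sub>R g x - integral k g)) < e / real (Suc n)"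
    proof (rule Henstock_lemma[of g c d "e / real (Suc n)"])
      show "g integrable_on cbox c d" using g by simp
    qed (use \<open>e / real (Suc n) > 0\<close> in blast)+
    \<comment> \<open>The segments between \<open>x\<close> and \<open>y\<close> form a Vitali cover of \<open>Bad n\<close>. A disjoint subfamily is a
      tagged partial division with tags at endpoints, whose total length the Henstock lemma bounds by \<open>e\<close>.\<close>
    define K where "K = {(x, y). x \<in> Bad n \<and> y \<in> {c..d} \<and> y \<noteq> x \<and> {min x y..max x y} \<subseteq> \<gamma> x \<and> bad n x y}"
    \<comment> \<open>The covering theorem is about balls, so a segment is recoded by midpoint and
      half-length.\<close>
    define mid where "mid = (\<lambda>(x, y). (x + y) / 2 :: real)"
    define rad where "rad = (\<lambda>(x, y). \<bar>y - x\<bar> / 2 :: real)"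
    have cball: "cball (mid (x, y)) (rad (x, y)) = {min x y..max x y}" for x y
      by (auto simp: mid_def rad_def cball_eq_atLeastAtMost min_def max_def field_simps)
    obtain C where C: "countable C" "C \<subseteq> K"
      "pairwise (\<lambda>i j. disjnt (cball (mid i) (rad i)) (cball (mid j) (rad j))) C"
      "negligible (Bad n - (\<Union>i\<in>C. cball (mid i) (rad i)))"
    proof (rule Vitali_covering_theorem_cballs[of K rad "Bad n" mid])
      show "0 < rad i" if "i \<in> K" for i
        using that by (auto simp: K_def rad_def)
      show "\<exists>i. i \<in> K \<and> x \<in> cball (mid i) (rad i) \<and> rad i < h" if x: "x \<in> Bad n" and "h > 0" for x h
      proof -
        obtain \<rho> where \<rho>: "\<rho> > 0" "ball x \<rho> \<subseteq> \<gamma> x"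
          using \<gamma>(1) unfolding gauge_def by (meson open_contains_ball)
        obtain y where y: "y \<in> {c..d}" "y \<noteq> x" "\<bar>y - x\<bar> < min \<rho> h" "bad n x y"
        proof -
          have "min \<rho> h > 0" using \<rho>(1) \<open>h > 0\<close> by simp
          then have "\<exists>y\<in>{c..d}. y \<noteq> x \<and> \<bar>y - x\<bar> < min \<rho> h \<and> bad n x y"
            using x unfolding Bad_def by blast
          then show ?thesis using that by blast
        qed
        have "{min x y..max x y} \<subseteq> ball x \<rho>"
          using y(3) by (auto simp: dist_real_def)
        then have "(x, y) \<in> K" using x y \<rho>(2) by (auto simp: K_def)
        moreover have "x \<in> cball (mid (x, y)) (rad (x, y))"
          unfolding cball by auto
        moreover have "rad (x, y) < h"
          using y(3) \<open>h > 0\<close> by (simp add: rad_def)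
        ultimately show ?thesis by blast
      qed
    qed blast
    have sum_le: "(\<Sum>i\<in>F. measure lebesgue (cball (mid i) (rad i))) \<le> e" if F: "finite F" "F \<subseteq> C" for F
    proof -
      define \<phi> where "\<phi> = (\<lambda>i. (fst i, cball (mid i) (rad i)))"
      have FK: "F \<subseteq> K" using F C by blast
      have disj: "cball (mid i) (rad i) \<inter> cball (mid j) (rad j) = {}" if "i \<in> F" "j \<in> F" "i \<noteq> j" for i j
        using C(3) F(2) that unfolding pairwise_def disjnt_def by blast
      have mem: "x \<in> cball (mid (x, y)) (rad (x, y))" for x y
        unfolding cball by auto
      have "inj_on \<phi> F"
      proof (rule inj_onI)
        fix i j assume *: "i \<in> F" "j \<in> F" "\<phi> i = \<phi> j"
        show "i = j"
        proof (rule ccontr)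
          assume "i \<noteq> j"
          then have "cball (mid i) (rad i) = {}" using disj[OF *(1,2)] *(3) by (simp add: \<phi>_def)
          then show False using mem[of "fst i" "snd i"] by simp
        qed
      qed
      have tag: "\<phi> ` F tagged_partial_division_of (cbox c d)"
        unfolding tagged_partial_division_of_def
      proof (intro conjI allI impI)
        show "finite (\<phi> ` F)" using F(1) by simp
      next
        fix x k assume "(x, k) \<in> \<phi> ` F"
        then obtain y where xy: "(x, y) \<in> K" "k = {min x y..max x y}"
          using FK by (auto simp: \<phi>_def cball)
        then show "x \<in> k" by auto
        show "k \<subseteq> cbox c d" using xy by (auto simp: K_def Bad_def)
        show "\<exists>a b. k = cbox a b" using xy(2) by auto
      next
        fix x1 k1 x2 k2
        assume "(x1, k1) \<in> \<phi> ` F \<and> (x2, k2) \<in> \<phi> ` F \<and> (x1, k1) \<noteq> (x2, k2)"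
        then obtain i j where "i \<in> F" "j \<in> F" "i \<noteq> j" "k1 = cball (mid i) (rad i)" "k2 = cball (mid j) (rad j)"
          by (auto simp: \<phi>_def)
        then have "k1 \<inter> k2 = {}" using disj by blast
        then show "interior k1 \<inter> interior k2 = {}" using interior_subset by blast
      qed
      have fine: "\<gamma> fine (\<phi> ` F)"
        unfolding fine_def
      proof
        fix p assume "p \<in> \<phi> ` F"
        then obtain x y where "(x, y) \<in> K" "p = (x, {min x y..max x y})"
          using FK by (auto simp: \<phi>_def cball)
        then show "case p of (x, k) \<Rightarrow> k \<subseteq> \<gamma> x" unfolding K_def by blast
      qed
      have "(\<Sum>i\<in>F. measure lebesgue (cball (mid i) (rad i))) \<le>
          (\<Sum>i\<in>F. real (Suc n) * (case \<phi> i of (x, k) \<Rightarrow> norm (measure lborel k *\<^sub>R g x - integral k g)))"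
      proof (rule sum_mono)
        fix i assume "i \<in> F"
        obtain x y where i: "i = (x, y)" by (cases i)
        then have K: "(x, y) \<in> K" using \<open>i \<in> F\<close> FK by blast
        then have xy: "c \<le> x" "x \<le> d" "c \<le> y" "y \<le> d" "bad n x y"
          by (auto simp: K_def Bad_def)
        \<comment> \<open>The tag may be the left or the right endpoint; exchanging them changes
          only a sign.\<close>
        have eq: "\<bar>\<bar>y - x\<bar> * g x - integral {min x y..max x y} g\<bar> = \<bar>G y - G x - g x * (y - x)\<bar>"
        proof (cases "x \<le> y")
          case True
          then show ?thesis using int_diff[of x y] xy by (simp add: min_def max_def algebra_simps)
        next
          case False
          then show ?thesis using int_diff[of y x] xy by (simp add: min_def max_def algebra_simps)
        qed
        have "measure lebesgue (cball (mid i) (rad i)) = \<bar>y - x\<bar>"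
          unfolding i cball by (simp add: min_def max_def)
        also have "\<dots> \<le> real (Suc n) * \<bar>\<bar>y - x\<bar> * g x - integral {min x y..max x y} g\<bar>"
          using xy(5) unfolding eq bad_def .
        also have "\<dots> = real (Suc n) * (case \<phi> i of (x, k) \<Rightarrow> norm (measure lborel k *\<^sub>R g x - integral k g))"
          unfolding i \<phi>_def cball by (simp add: min_def max_def)
        finally show "measure lebesgue (cball (mid i) (rad i)) \<le>
            real (Suc n) * (case \<phi> i of (x, k) \<Rightarrow> norm (measure lborel k *\<^sub>R g x - integral k g))" .
      qed
      also have "\<dots> = real (Suc n) * (\<Sum>(x, k)\<in>\<phi> ` F. norm (measure lborel k *\<^sub>R g x - integral k g))"
        by (simp add: sum_distrib_left[symmetric] sum.reindex[OF \<open>inj_on \<phi> F\<close>])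
      also have "\<dots> \<le> real (Suc n) * (e / real (Suc n))"
        using \<gamma>(2)[OF tag fine] by (intro mult_left_mono) auto
      finally show ?thesis by simp
    qed
    let ?U = "\<Union>i\<in>C. cball (mid i) (rad i)"
    have *: "measure lebesgue (\<Union>i\<in>F. cball (mid i) (rad i)) \<le> e" if "finite F" "F \<subseteq> C" for F
      using measure_UNION_le[OF that(1), of "\<lambda>i. cball (mid i) (rad i)" lebesgue] sum_le[OF that] by simp
    have U: "?U \<in> lmeasurable" "measure lebesgue ?U \<le> e"
      using fmeasurable_UN_bound[OF C(1), of "\<lambda>i. cball (mid i) (rad i)" lebesgue e]
        measure_UN_bound[OF C(1), of "\<lambda>i. cball (mid i) (rad i)" lebesgue e] * by auto
    \<comment> \<open>The Vitali family misses a null set only; adding it yields a cover of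
      \<open>Bad n\<close> without increasing the measure.\<close>
    let ?Z = "Bad n - ?U"
    have "measure lebesgue (?U \<union> ?Z) = measure lebesgue ?U"
      using C(4) U(1) by (intro measure_Un_null_set) (auto simp: negligible_iff_null_sets fmeasurableD)
    moreover have "?U \<union> ?Z \<in> lmeasurable"
      by (rule fmeasurable.Un[OF U(1) negligible_imp_measurable[OF C(4)]])
    ultimately show "\<exists>T. Bad n \<subseteq> T \<and> T \<in> lmeasurable \<and> measure lebesgue T \<le> e"
      using U(2) by (intro exI[of _ "?U \<union> ?Z"]) auto
  qed
  then have "negligible (\<Union>n. Bad n)" by (intro negligible_countable_Union) auto
  moreover have "(G has_real_derivative g x) (at x)" if x: "x \<in> {c<..<d}" "x \<notin> (\<Union>n. Bad n)" for x
    unfolding has_field_derivative_iff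
  proof (rule tendstoI)
    fix e :: real assume "e > 0"
    then obtain n where n: "inverse (real (Suc n)) < e"
      using reals_Archimedean by blast
    have "\<exists>h>0. \<forall>y\<in>{c..d}. y \<noteq> x \<and> \<bar>y - x\<bar> < h \<longrightarrow> \<not> bad n x y"
      using x unfolding Bad_def by blast
    then obtain h where h: "h > 0" "\<And>y. y \<in> {c..d} \<Longrightarrow> y \<noteq> x \<Longrightarrow> \<bar>y - x\<bar> < h \<Longrightarrow> \<not> bad n x y"
      by blast
    \<comment> \<open>The distances to \<open>c\<close> and \<open>d\<close> enter because
      \<open>Bad\<close> tests only points of {c..d}.\<close>
    have "dist ((G y - G x) / (y - x)) (g x) < e"
      if y: "y \<noteq> x" "dist y x < min h (min (x - c) (d - x))" for y
    proof -
      have "real (Suc n) * \<bar>G y - G x - g x * (y - x)\<bar> < \<bar>y - x\<bar>"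
      proof -
        have "\<bar>y - x\<bar> < h" "\<bar>y - x\<bar> < x - c" "\<bar>y - x\<bar> < d - x"
          using y(2) by (simp_all add: dist_real_def)
        moreover from this have "y \<in> {c..d}" by auto
        ultimately show ?thesis using h(2)[of y] y(1) by (simp add: bad_def)
      qed
      then have "\<bar>G y - G x - g x * (y - x)\<bar> < inverse (real (Suc n)) * \<bar>y - x\<bar>"
        by (simp add: field_simps)
      also have "\<dots> < e * \<bar>y - x\<bar>" using n y by (intro mult_strict_right_mono) auto
      finally have "\<bar>G y - G x - g x * (y - x)\<bar> / \<bar>y - x\<bar> < e" using y by (simp add: field_simps)
      moreover have "\<bar>(G y - G x) / (y - x) - g x\<bar> = \<bar>G y - G x - g x * (y - x)\<bar> / \<bar>y - x\<bar>"
        using y by (simp add: abs_divide[symmetric] diff_divide_distrib)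
      ultimately show ?thesis by (simp add: dist_real_def)
    qed
    then show "\<forall>\<^sub>F y in at x. dist ((G y - G x) / (y - x)) (g x) < e"
      unfolding eventually_at using h(1) x(1) by (intro exI[of _ "min h (min (x - c) (d - x))"]) auto
  qed
  ultimately show ?thesis
    unfolding G_def by (elim negligible_subset) blast
qed

text \<open>Both properties of the same \<open>g\<close> are used: the integral formula for the
  integration by parts, the pointwise derivative for identifying \<open>deriv f\<close>.\<close>

lemma abs_continuous_on_fundamental_theorem:
  assumes ac: "abs_continuous_on {c..d} f" and "c < d"
  obtains g :: "real \<Rightarrow> real" where "integrable lborel g"
    "\<And>x. x \<in> {c..d} \<Longrightarrow> (LINT y:{c..x}|lborel. g y) = f x - f c"
    "negligible {x \<in> {c<..<d}. \<not> (f has_real_derivative g x) (at x)}"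
proof -
  obtain g :: "real \<Rightarrow> real" where g: "integrable lborel g"
    "\<And>x. x \<in> {c..d} \<Longrightarrow> (LINT y:{c..x}|lborel. g y) = f x - f c"
    using abs_continuous_on_density[OF assms] by blast
  have si: "set_integrable lborel {c..x} g" for x
    unfolding set_integrable_def by (intro integrable_mult_indicator g(1)) simp
  have int: "integral {c..x} g = f x - f c" if "x \<in> {c..d}" for x
    using g(2)[OF that] set_borel_integral_eq_integral(2)[OF si] by simp
  have "g integrable_on {c..d}" by (rule set_borel_integral_eq_integral(1)[OF si])
  then have "negligible {x \<in> {c<..<d}. \<not> ((\<lambda>y. integral {c..y} g) has_real_derivative g x) (at x)}"
    by (rule negligible_not_has_real_derivative_integral)
  moreover have "(f has_real_derivative g x) (at x)"
    if x: "x \<in> {c<..<d}" and D: "((\<lambda>y. integral {c..y} g) has_real_derivative g x) (at x)" for x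
  proof -
    have "((\<lambda>y. integral {c..y} g + f c) has_real_derivative g x) (at x)"
      using D by (auto intro!: derivative_eq_intros)
    then show ?thesis
    proof (rule has_field_derivative_transform_within_open)
      show "open {c<..<d}" "x \<in> {c<..<d}" using x by auto
      show "integral {c..y} g + f c = f y" if "y \<in> {c<..<d}" for y
        using int[of y] that by simp
    qed
  qed
  ultimately have "negligible {x \<in> {c<..<d}. \<not> (f has_real_derivative g x) (at x)}"
    by (elim negligible_subset) blast
  then show thesis using that g by blast
qed

section \<open>The right limit and the extension to the closed interval\<close>

text \<open>\<open>Lim\<close> denotes the limit only if there is one; uniform continuity provides
  it by extension to the closure.\<close>

lemma abs_continuous_on_at_right_tendsto:
  assumes ac: "abs_continuous_on {a<..<b} f" and "a < b"
  shows "(f \<longlongrightarrow> Lim (at_right a) f) (at_right a)"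
proof -
  have "uniformly_continuous_on {a<..<b} f"
    by (rule abs_continuous_on_imp_uniformly_continuous_on[OF ac is_interval_oo])
  moreover have "a \<in> closure {a<..<b}" using \<open>a < b\<close> by simp
  ultimately obtain l where "(f \<longlongrightarrow> l) (at a within {a<..<b})"
    using uniformly_continuous_on_extension_at_closure[of "{a<..<b}" f a] by blast
  moreover have "at a within {a<..<b} = at_right a"
    using \<open>a < b\<close> by (intro at_within_nhd[of _ "{..<b}"]) auto
  ultimately have "(f \<longlongrightarrow> l) (at_right a)" by simp
  moreover from this have "Lim (at_right a) f = l"
    by (intro tendsto_Lim) (simp_all add: trivial_limit_at_right_real)
  ultimately show ?thesis by simp
qed

text \<open>Once the value at \<open>a\<close> is the right limit, increments over intervals
  starting at \<open>a\<close> are limits of increments over intervals inside {a<..<b}.\<close>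

lemma abs_continuous_on_extend_left:
  assumes ac: "abs_continuous_on {a<..<b} f" and "a < t" "t < b"
    and lim: "(f \<longlongrightarrow> l) (at_right a)"
  shows "abs_continuous_on {a..t} (f(a := l))"
  unfolding abs_continuous_on_iff
proof (intro allI impI)
  fix \<epsilon> :: real assume "\<epsilon> > 0"
  let ?f = "f(a := l)"
  \<comment> \<open>Half of \<epsilon>, because the passage to the limit leaves only a weak
    inequality.\<close>
  obtain \<delta> where \<delta>: "\<delta> > 0"
    "\<And>D. interval_family {a<..<b} D \<Longrightarrow> (\<Sum>(u, v)\<in>D. v - u) < \<delta> \<Longrightarrow> (\<Sum>(u, v)\<in>D. \<bar>f v - f u\<bar>) < \<epsilon>/2"
    using abs_continuous_onD[OF ac, of "\<epsilon>/2"] \<open>\<epsilon> > 0\<close> by (metis half_gt_zero)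
  have "(\<Sum>(u, v)\<in>D. \<bar>?f v - ?f u\<bar>) < \<epsilon>"
    if D: "interval_family {a..t} D" and len: "(\<Sum>(u, v)\<in>D. v - u) < \<delta>" for D
  proof -
    note D' = interval_familyD[OF D]
    have bnd: "a \<le> u \<and> u < v \<and> v \<le> t" if "(u, v) \<in> D" for u v
      using D'(2,3)[OF that] by auto
    \<comment> \<open>Intervals starting at \<open>a\<close> are shortened to start at \<open>a + h\<close>, and then \<open>h\<close> tends to \<open>0\<close>.\<close>
    have lim_left: "((\<lambda>h. ?f (max (a + h) u)) \<longlongrightarrow> ?f u) (at_right 0)" if "a \<le> u" for u
    proof (cases "u = a")
      case True
      have "((\<lambda>h. f (a + h)) \<longlongrightarrow> l) (at_right 0)"
        using lim unfolding filterlim_at_right_to_0[of f _ a] by (simp add: add.commute)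
      moreover have "\<forall>\<^sub>F h in at_right 0. f (a + h) = ?f (max (a + h) u)"
        unfolding eventually_at_right_field using True by (intro exI[of _ 1]) auto
      ultimately show ?thesis using True by (simp add: tendsto_cong)
    next
      case False
      then have "\<forall>\<^sub>F h in at_right 0. ?f u = ?f (max (a + h) u)"
        unfolding eventually_at_right_field using that by (intro exI[of _ "u - a"]) (auto simp: max_def)
      then show ?thesis by (rule Lim_transform_eventually[OF tendsto_const])
    qed
    have "((\<lambda>h. \<Sum>(u, v)\<in>D. \<bar>?f v - ?f (max (a + h) u)\<bar>) \<longlongrightarrow> (\<Sum>(u, v)\<in>D. \<bar>?f v - ?f u\<bar>)) (at_right 0)"
      unfolding case_prod_unfold
    proof (intro tendsto_sum tendsto_rabs tendsto_diff tendsto_const lim_left)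
      show "a \<le> fst p" if "p \<in> D" for p using bnd[of "fst p" "snd p"] that by simp
    qed
    moreover have "\<forall>\<^sub>F h in at_right 0. (\<Sum>(u, v)\<in>D. \<bar>?f v - ?f (max (a + h) u)\<bar>) \<le> \<epsilon>/2"
    proof -
      \<comment> \<open>As \<open>D\<close> is finite, all small \<open>h\<close> leave every
        shortened interval nondegenerate at once.\<close>
      have "\<forall>\<^sub>F h in at_right 0. \<forall>p\<in>D. a + h < snd p"
      proof (intro eventually_ball_finite D'(1) ballI)
        fix p assume "p \<in> D"
        then show "\<forall>\<^sub>F h in at_right 0. a + h < snd p"
          unfolding eventually_at_right_field using bnd[of "fst p" "snd p"]
          by (intro exI[of _ "snd p - a"]) auto
      qed
      moreover have "\<forall>\<^sub>F h in at_right 0. (h::real) > 0" by (rule eventually_at_right_less)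
      ultimately show ?thesis
      proof eventually_elim
        case (elim h)
        define \<phi> where "\<phi> = (\<lambda>(u, v). (max (a + h) u, v :: real))"
        have \<phi>: "fst (\<phi> p) < snd (\<phi> p)" "fst p \<le> fst (\<phi> p)" "snd (\<phi> p) = snd p" "a < fst (\<phi> p)" if "p \<in> D" for p
          using that bnd[of "fst p" "snd p"] elim by (auto simp: \<phi>_def split: prod.splits)
        have sep: "{fst (\<phi> p)<..<snd (\<phi> p)} \<inter> {fst (\<phi> q)<..<snd (\<phi> q)} = {}" if "p \<in> D" "q \<in> D" "p \<noteq> q" for p q
        proof -
          have "{fst p<..<snd p} \<inter> {fst q<..<snd q} = {}"
            using D'(4)[of "fst p" "snd p" "fst q" "snd q"] that by (simp add: prod_eq_iff)
          moreover have "{fst (\<phi> p)<..<snd (\<phi> p)} \<subseteq> {fst p<..<snd p}" "{fst (\<phi> q)<..<snd (\<phi> q)} \<subseteq> {fst q<..<snd q}"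
            using \<phi>[OF that(1)] \<phi>[OF that(2)] by auto
          ultimately show ?thesis by blast
        qed
        have inj: "inj_on \<phi> D"
        proof (rule inj_onI, rule ccontr)
          fix p q assume "p \<in> D" "q \<in> D" "\<phi> p = \<phi> q" "p \<noteq> q"
          then show False using sep[of p q] \<phi>(1)[of q] by simp
        qed
        have "interval_family {a<..<b} (\<phi> ` D)"
        proof (rule interval_familyI)
          show "finite (\<phi> ` D)" using D'(1) by simp
          show "u < v" "{u..v} \<subseteq> {a<..<b}" if mem: "(u, v) \<in> \<phi> ` D" for u v
          proof -
            obtain p where "p \<in> D" "\<phi> p = (u, v)" using mem by auto
            then show "u < v" "{u..v} \<subseteq> {a<..<b}"
              using \<phi>[of p] bnd[of "fst p" "snd p"] \<open>t < b\<close> by auto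
          qed
          show "{u<..<v} \<inter> {u'<..<v'} = {}"
            if mem: "(u, v) \<in> \<phi> ` D" "(u', v') \<in> \<phi> ` D" "(u, v) \<noteq> (u', v')" for u v u' v'
          proof -
            obtain p q where "p \<in> D" "\<phi> p = (u, v)" "q \<in> D" "\<phi> q = (u', v')" using mem(1,2) by fastforce
            then show ?thesis using sep[of p q] mem(3) by (metis fst_conv snd_conv)
          qed
        qed
        moreover have "(\<Sum>(u, v)\<in>\<phi> ` D. v - u) < \<delta>"
        proof -
          have "(\<Sum>(u, v)\<in>\<phi> ` D. v - u) \<le> (\<Sum>(u, v)\<in>D. v - u)"
            unfolding sum.reindex[OF inj] by (intro sum_mono) (use \<phi> in \<open>force simp: case_prod_unfold\<close>)
          then show ?thesis using len by simp
        qed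
        ultimately have "(\<Sum>(u, v)\<in>\<phi> ` D. \<bar>f v - f u\<bar>) < \<epsilon>/2" by (rule \<delta>(2))
        also have "(\<Sum>(u, v)\<in>\<phi> ` D. \<bar>f v - f u\<bar>) = (\<Sum>(u, v)\<in>D. \<bar>?f v - ?f (max (a + h) u)\<bar>)"
          unfolding sum.reindex[OF inj]
        proof (intro sum.cong refl)
          fix p assume "p \<in> D"
          obtain u v where p: "p = (u, v)" by (cases p)
          \<comment> \<open>Neither endpoint is \<open>a\<close> any more, so \<open>f\<close> and
            its update agree on both.\<close>
          then have "v \<noteq> a" "max (a + h) u \<noteq> a" using bnd[of u v] \<open>p \<in> D\<close> elim(2) by auto
          then show "((\<lambda>(u, v). \<bar>f v - f u\<bar>) \<circ> \<phi>) p = (case p of (u, v) \<Rightarrow> \<bar>?f v - ?f (max (a + h) u)\<bar>)"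
            by (simp add: p \<phi>_def)
        qed
        finally show ?case by simp
      qed
    qed
    ultimately have "(\<Sum>(u, v)\<in>D. \<bar>?f v - ?f u\<bar>) \<le> \<epsilon>/2"
      by (intro tendsto_upperbound) (auto simp: trivial_limit_at_right_real)
    then show ?thesis using \<open>\<epsilon> > 0\<close> by simp
  qed
  then show "\<exists>\<delta>>0. \<forall>D. interval_family {a..t} D \<longrightarrow> (\<Sum>(u, v)\<in>D. v - u) < \<delta> \<longrightarrow>
      (\<Sum>(u, v)\<in>D. \<bar>?f v - ?f u\<bar>) < \<epsilon>"
    using \<delta>(1) by blast
qed

subsection \<open>The Mittag-Leffler series and the power kernel\<close>

text \<open>Discard the Gamma integral below \<open>R\<close> and replace t^x by R^x beyond it. As
  \<open>R\<close> is free, Gamma(\<alpha>k + 1) outgrows every geometric sequence.\<close>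

lemma Gamma_plus1_ge_powr_exp:
  fixes x R :: real
  assumes "x \<ge> 0" "R > 0"
  shows "R powr x * exp (- R) \<le> Gamma (x + 1)"
proof -
  have "((\<lambda>t. R powr x * exp (- t)) has_integral R powr x * exp (- R)) {R..}"
    using has_integral_mult_right[OF has_integral_exp_minus_to_infinity[of 1 R], of "R powr x"] by simp
  then have "((\<lambda>t. if t \<in> {R..} then R powr x * exp (- t) else 0) has_integral R powr x * exp (- R)) {0..}"
    using assms(2) by (subst has_integral_restrict) auto
  moreover have "((\<lambda>t. t powr x / exp t) has_integral Gamma (x + 1)) {0..}"
    using Gamma_integral_real[of "x + 1"] assms(1) by simp
  ultimately show ?thesis
  proof (rule has_integral_le)
    show "(if t \<in> {R..} then R powr x * exp (- t) else 0) \<le> t powr x / exp t" for t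
      using assms powr_mono2[of x R t] by (auto simp: exp_minus field_simps)
  qed
qed

lemma summable_norm_mittag_leffler:
  fixes \<alpha> z :: real
  assumes "\<alpha> > 0"
  shows "summable (\<lambda>k. norm (z ^ k / Gamma (\<alpha> * real k + 1)))"
proof (rule summable_comparison_test')
  \<comment> \<open>The factor 2 makes |z| / q at most 1/2; the 1 keeps \<open>q\<close> positive
    for z = 0.\<close>
  define q where "q = 2 * (\<bar>z\<bar> + 1)"
  \<comment> \<open>Chosen such that \<open>R powr (\<alpha> * k) = q ^ k\<close> outgrows \<open>\<bar>z\<bar> ^ k\<close>.\<close>
  define R where "R = q powr (1 / \<alpha>)"
  have "q > 0" by (simp add: q_def)
  then have "R > 0" by (simp add: R_def)
  have Rpow: "R powr (\<alpha> * real k) = q ^ k" for k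
    using assms \<open>q > 0\<close> by (simp add: R_def powr_powr powr_realpow)
  show "summable (\<lambda>k. exp R * (1/2) ^ k)"
    by (intro summable_mult summable_geometric) simp
  show "norm (norm (z ^ k / Gamma (\<alpha> * real k + 1))) \<le> exp R * (1/2) ^ k" if "k \<ge> 0" for k
  proof -
    have "q ^ k * exp (- R) \<le> Gamma (\<alpha> * real k + 1)"
      using Gamma_plus1_ge_powr_exp[of "\<alpha> * real k" R] assms \<open>R > 0\<close> Rpow by simp
    moreover have "q ^ k * exp (- R) > 0" using \<open>q > 0\<close> by simp
    ultimately have "\<bar>z\<bar> ^ k / Gamma (\<alpha> * real k + 1) \<le> \<bar>z\<bar> ^ k / (q ^ k * exp (- R))"
      using Gamma_real_pos[of "\<alpha> * real k + 1"] assms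
      by (intro divide_left_mono) (simp_all add: add_nonneg_pos)
    also have "\<dots> = exp R * (\<bar>z\<bar> / q) ^ k"
      by (simp add: exp_minus power_divide field_simps)
    also have "\<dots> \<le> exp R * (1/2) ^ k"
      by (intro mult_left_mono power_mono) (auto simp: q_def field_simps)
    finally show ?thesis
      using assms Gamma_real_pos[of "\<alpha> * real k + 1"] by (simp add: power_abs abs_divide add_nonneg_pos)
  qed
qed

section \<open>Integration by parts against the power kernel\<close>

text \<open>For \<sigma> < 1 the integrand is singular at s = t, but its antiderivative is
  continuous there, so derivatives in the interior suffice. Nonnegativity upgrades Henstock-Kurzweil
  to Lebesgue integrability.\<close>

lemma has_bochner_integral_powr_kernel:
  fixes \<sigma> t x :: real
  assumes "\<sigma> > 0" "x \<le> t"
  shows "has_bochner_integral lborel (\<lambda>s. indicator {x..t} s * (\<sigma> * (t - s) powr (\<sigma> - 1))) ((t - x) powr \<sigma>)"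
proof -
  let ?k = "\<lambda>s. \<sigma> * (t - s) powr (\<sigma> - 1)"
  have HK: "(?k has_integral (t - x) powr \<sigma>) {x..t}"
  proof -
    have "(?k has_integral (- ((t - t) powr \<sigma>) - - ((t - x) powr \<sigma>))) {x..t}"
    proof (rule fundamental_theorem_of_calculus_interior)
      show "continuous_on {x..t} (\<lambda>s. - ((t - s) powr \<sigma>))"
        using assms(1) by (intro continuous_intros continuous_on_powr') auto
      show "((\<lambda>s. - ((t - s) powr \<sigma>)) has_vector_derivative ?k s) (at s)" if "s \<in> {x<..<t}" for s
        unfolding has_real_derivative_iff_has_vector_derivative[symmetric]
        using that by (auto intro!: derivative_eq_intros)
    qed (fact assms(2))
    then show ?thesis using assms(1) by simp
  qed
  have "(?k has_integral (t - x) powr \<sigma>) {x..t} \<Longrightarrow> ?k absolutely_integrable_on {x..t}"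
    using assms(1) by (intro nonnegative_absolutely_integrable_1) (auto simp: integrable_on_def)
  with HK have "integrable lebesgue (\<lambda>s. indicator {x..t} s *\<^sub>R ?k s)"
    by (simp add: set_integrable_def)
  then have int: "set_integrable lborel {x..t} ?k"
    unfolding set_integrable_def by (subst (asm) integrable_completion) simp_all
  then have "(LINT s:{x..t}|lborel. ?k s) = (t - x) powr \<sigma>"
    using set_borel_integral_eq_integral(2)[OF int] integral_unique[OF HK] by (simp only:)
  then show ?thesis
    using int unfolding has_bochner_integral_iff set_integrable_def set_lebesgue_integral_def by simp
qed

text \<open>No product has to be differentiated: Fubini applies once
  \<open>(t - x) powr \<sigma>\<close> is written as the integral of its derivative.\<close>
lemma powr_kernel_integral_by_parts:
  fixes g :: "real \<Rightarrow> real"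
  assumes g: "integrable lborel g" and "\<sigma> > 0" and "a \<le> t"
  shows "set_integrable lborel {a..t} (\<lambda>s. \<sigma> * (t - s) powr (\<sigma> - 1) * (LINT x:{a..s}|lborel. g x))"
    and "(LINT x:{a..t}|lborel. (t - x) powr \<sigma> * g x) =
         (LINT s:{a..t}|lborel. \<sigma> * (t - s) powr (\<sigma> - 1) * (LINT x:{a..s}|lborel. g x))"
proof -
  have [measurable]: "g \<in> borel_measurable borel"
    using borel_measurable_integrable[OF g] by simp
  let ?k = "\<lambda>s. indicator {a..t} s * (\<sigma> * (t - s) powr (\<sigma> - 1))"
  \<comment> \<open>Supported on the triangle a \<le> x \<le> s \<le> t: integrating out
    \<open>s\<close> leaves the power, integrating out \<open>x\<close> the primitive of
    \<open>g\<close>.\<close>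
  define \<Phi> where "\<Phi> = (\<lambda>x s. (indicator {a..t} x * g x) * (indicator {x..t} s * (\<sigma> * (t - s) powr (\<sigma> - 1))))"
  have k: "integrable lborel ?k"
    using has_bochner_integral_powr_kernel[OF assms(2,3)] by (rule integrable.intros)
  have meas: "case_prod \<Phi> \<in> borel_measurable (lborel \<Otimes>\<^sub>M lborel)"
  proof -
    \<comment> \<open>The endpoint of {x..t} varies, so its indicator becomes a comparison of
      \<open>x\<close> and \<open>s\<close>, which is visibly jointly measurable.\<close>
    have eq: "case_prod \<Phi> = (\<lambda>(x, s). indicator {a..t} x * g x *
        ((if x \<le> s then 1 else 0) * (indicator {..t} s * (\<sigma> * (t - s) powr (\<sigma> - 1)))))"
      by (auto simp: \<Phi>_def fun_eq_iff indicator_def)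
    show ?thesis unfolding eq by measurable
  qed
  have int: "integrable (lborel \<Otimes>\<^sub>M lborel) (case_prod \<Phi>)"
  \<comment> \<open>Dropping the conditions on \<open>x\<close> separates the variables: the
    majorant is a product of two integrable functions.\<close>
  proof (rule Bochner_Integration.integrable_bound[OF _ meas])
    show "integrable (lborel \<Otimes>\<^sub>M lborel) (\<lambda>(x, s). g x * ?k s)"
    proof (rule lborel_pair.Fubini_integrable)
      show "(\<lambda>(x, s). g x * ?k s) \<in> borel_measurable (lborel \<Otimes>\<^sub>M lborel)" by measurable
      show "integrable lborel (\<lambda>x. \<integral>s. norm (case (x, s) of (x, s) \<Rightarrow> g x * ?k s) \<partial>lborel)"
        using g by (simp add: abs_mult)
      show "AE x in lborel. integrable lborel (\<lambda>s. case (x, s) of (x, s) \<Rightarrow> g x * ?k s)"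
        using k by simp
    qed
    show "AE p in lborel \<Otimes>\<^sub>M lborel. norm (case_prod \<Phi> p) \<le> norm (case p of (x, s) \<Rightarrow> g x * ?k s)"
      by (intro AE_I2) (auto simp: \<Phi>_def indicator_def abs_mult split: prod.splits)
  qed
  have 1: "(\<integral>s. \<Phi> x s \<partial>lborel) = indicator {a..t} x *\<^sub>R ((t - x) powr \<sigma> * g x)" for x
  proof (cases "x \<in> {a..t}")
    case True
    then have "(\<integral>s. indicator {x..t} s * (\<sigma> * (t - s) powr (\<sigma> - 1)) \<partial>lborel) = (t - x) powr \<sigma>"
      using has_bochner_integral_powr_kernel[OF assms(2), of x t] by (simp add: has_bochner_integral_iff)
    then show ?thesis using True by (simp add: \<Phi>_def mult.commute)
  qed (simp add: \<Phi>_def)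
  have 2: "(\<integral>x. \<Phi> x s \<partial>lborel) =
      indicator {a..t} s *\<^sub>R (\<sigma> * (t - s) powr (\<sigma> - 1) * (LINT x:{a..s}|lborel. g x))" for s
  proof (cases "s \<in> {a..t}")
    case True
    have "\<Phi> x s = \<sigma> * (t - s) powr (\<sigma> - 1) * (indicator {a..s} x *\<^sub>R g x)" for x
      using True by (auto simp: \<Phi>_def indicator_def)
    then show ?thesis using True by (simp add: set_lebesgue_integral_def)
  next
    case False
    then have "\<Phi> x s = 0" for x by (auto simp: \<Phi>_def indicator_def)
    then show ?thesis using False by simp
  qed
  show "set_integrable lborel {a..t} (\<lambda>s. \<sigma> * (t - s) powr (\<sigma> - 1) * (LINT x:{a..s}|lborel. g x))"
    unfolding set_integrable_def using lborel_pair.integrable_snd[OF int] by (simp add: 2)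
  show "(LINT x:{a..t}|lborel. (t - x) powr \<sigma> * g x) =
         (LINT s:{a..t}|lborel. \<sigma> * (t - s) powr (\<sigma> - 1) * (LINT x:{a..s}|lborel. g x))"
    using lborel_pair.Fubini_integral[OF int] unfolding 1 2 set_lebesgue_integral_def by simp
qed

section \<open>Termwise integration and assembly of the formula\<close>

text \<open>The operators integrate over the open interval in \<open>lebesgue\<close>, with
  \<open>deriv f\<close> equal to the density only off a null set; Fubini was carried out over the
  closed interval in \<open>lborel\<close>. The Henstock-Kurzweil integral, blind to null sets and
  endpoints, connects the two.\<close>

lemma set_integral_lebesgue_Ioo_eq_lborel_Icc:
  fixes h h' :: "real \<Rightarrow> real"
  assumes h: "set_integrable lborel {a..t} h" and N: "negligible N"
    and eq: "\<And>x. x \<in> {a<..<t} - N \<Longrightarrow> h' x = h x"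
  shows "(LINT x:{a<..<t}|lebesgue. h' x) = (LINT x:{a..t}|lborel. h x)"
proof -
  have "integrable lebesgue (\<lambda>x. indicator {a..t} x *\<^sub>R h x)"
    using h unfolding set_integrable_def by (subst integrable_completion) (auto dest: borel_measurable_integrable)
  then have "h absolutely_integrable_on {a..t}" by (simp add: set_integrable_def)
  then have "h absolutely_integrable_on {a<..<t}"
    by (rule set_integrable_subset) auto
  then have "h' absolutely_integrable_on {a<..<t}"
    using absolutely_integrable_spike[OF _ N] eq by blast
  then have "(LINT x:{a<..<t}|lebesgue. h' x) = integral {a<..<t} h'"
    by (rule set_lebesgue_integral_eq_integral(2))
  also have "\<dots> = integral {a<..<t} h"
    by (rule integral_spike[OF N]) (use eq in auto)
  also have "\<dots> = integral {a..t} h" by (rule integral_open_interval_real[symmetric])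
  also have "\<dots> = (LINT x:{a..t}|lborel. h x)"
    using set_borel_integral_eq_integral(2)[OF h] by simp
  finally show ?thesis .
qed

theorem theorem5:
  fixes a b \<alpha> :: real and f B :: "real \<Rightarrow> real"
  assumes "a < b"
    and "abs_continuous_on {a<..<b} f"
    and "0 < \<alpha>" and "\<alpha> < 1"
    and "B 0 = 1" and "B 1 = 1"
  shows "\<forall>t\<in>{a<..<b}.
     summable (\<lambda>k. (- (\<alpha> / (1 - \<alpha>))) ^ k * rl_integral a (\<alpha> * real k) f t) \<and>
     abc_derivative B \<alpha> a f t =
       - (B \<alpha> * Lim (at_right a) f / (1 - \<alpha>)) *
           mittag_leffler \<alpha> (- (\<alpha> * (t - a) powr \<alpha> / (1 - \<alpha>)))
       + B \<alpha> / (1 - \<alpha>) *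
           (\<Sum>k. (- (\<alpha> / (1 - \<alpha>))) ^ k * rl_integral a (\<alpha> * real k) f t)"
proof
  fix t assume "t \<in> {a<..<b}"
  then have t: "a < t" "t < b" by auto
  define L where "L = Lim (at_right a) f"
  define c where "c = - (\<alpha> / (1 - \<alpha>))"
  \<comment> \<open>Differs from \<open>f\<close> only at \<open>a\<close>, which the integrals over
    {a<..<t} do not see.\<close>
  let ?f = "f(a := L)"
  have "(f \<longlongrightarrow> L) (at_right a)"
    unfolding L_def by (rule abs_continuous_on_at_right_tendsto[OF assms(2,1)])
  then have ac: "abs_continuous_on {a..t} ?f"
    by (rule abs_continuous_on_extend_left[OF assms(2) t])
  obtain g :: "real \<Rightarrow> real" where g: "integrable lborel g"
    "\<And>x. x \<in> {a..t} \<Longrightarrow> (LINT y:{a..x}|lborel. g y) = ?f x - ?f a"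
    "negligible {x \<in> {a<..<t}. \<not> (?f has_real_derivative g x) (at x)}"
    using abs_continuous_on_fundamental_theorem[OF ac t(1)] by blast
  have [measurable]: "g \<in> borel_measurable borel"
    using borel_measurable_integrable[OF g(1)] by simp
  have FTC: "(LINT y:{a..x}|lborel. g y) = ?f x - L" if "x \<in> {a..t}" for x
    using g(2)[OF that] by simp
  define ml where "ml = (\<lambda>k x. (c * (t - x) powr \<alpha>) ^ k / Gamma (\<alpha> * real k + 1))"
  have suml: "summable (\<lambda>k. norm (ml k x))" for x
    unfolding ml_def by (rule summable_norm_mittag_leffler[OF assms(3)])
  have E: "mittag_leffler \<alpha> (c * (t - x) powr \<alpha>) = (\<Sum>k. ml k x)" for x
    by (simp add: mittag_leffler_def ml_def)
  \<comment> \<open>The base \<open>t - x\<close> is largest at \<open>x = a\<close>, so the terms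
    at \<open>a\<close> form a summable majorant independent of \<open>x\<close>.\<close>
  have ml_le: "norm (ml k x) \<le> norm (ml k a)" if "x \<in> {a..t}" for k x
    unfolding ml_def norm_divide norm_power norm_mult
    using that assms(3) by (intro divide_right_mono power_mono mult_left_mono) (auto intro!: powr_mono2)
  define \<psi> where "\<psi> = (\<lambda>k x. indicator {a..t} x *\<^sub>R (ml k x * g x))"
  have \<psi>_le: "norm (\<psi> k x) \<le> norm (ml k a) * norm (g x)" for k x
    using ml_le[of x k] by (auto simp: \<psi>_def indicator_def abs_mult intro!: mult_right_mono)
  have \<psi>: "integrable lborel (\<psi> k)" for k
  proof (rule Bochner_Integration.integrable_bound)
    show "integrable lborel (\<lambda>x. norm (ml k a) * norm (g x))" using g(1) by simp
    show "\<psi> k \<in> borel_measurable lborel" unfolding \<psi>_def ml_def by measurable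
    show "AE x in lborel. norm (\<psi> k x) \<le> norm (norm (ml k a) * norm (g x))"
      using \<psi>_le by (intro AE_I2) (simp add: abs_mult)
  qed
  have \<psi>_sum: "summable (\<lambda>k. norm (\<psi> k x))" for x
    by (rule summable_comparison_test'[OF summable_mult2[OF suml[of a], of "norm (g x)"], of 0]) (use \<psi>_le in simp)
  \<comment> \<open>Besides pointwise absolute convergence, the exchange of sum and integral needs a
    convergent series of L1 norms.\<close>
  have \<psi>_int_sum: "summable (\<lambda>k. \<integral>x. norm (\<psi> k x) \<partial>lborel)"
  proof (rule summable_comparison_test'[OF summable_mult2[OF suml[of a], of "\<integral>x. norm (g x) \<partial>lborel"], of 0])
    fix k
    have "(\<integral>x. norm (\<psi> k x) \<partial>lborel) \<le> (\<integral>x. norm (ml k a) * norm (g x) \<partial>lborel)"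
      using \<psi> g(1) \<psi>_le by (intro integral_mono) auto
    then show "norm (\<integral>x. norm (\<psi> k x) \<partial>lborel) \<le> norm (ml k a) * (\<integral>x. norm (g x) \<partial>lborel)" by simp
  qed
  define I where "I = (LINT x:{a..t}|lborel. mittag_leffler \<alpha> (c * (t - x) powr \<alpha>) * g x)"
  have \<psi>_suminf: "(\<Sum>k. \<psi> k x) = indicator {a..t} x *\<^sub>R (mittag_leffler \<alpha> (c * (t - x) powr \<alpha>) * g x)" for x
    using suminf_mult2[OF summable_norm_cancel[OF suml[of x]], of "g x"] by (simp add: \<psi>_def E indicator_def)
  have sums_I: "(\<lambda>k. integral\<^sup>L lborel (\<psi> k)) sums I"
    using sums_integral[OF \<psi> AE_I2[OF \<psi>_sum] \<psi>_int_sum]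
    unfolding \<psi>_suminf I_def set_lebesgue_integral_def .
  have intE: "set_integrable lborel {a..t} (\<lambda>x. mittag_leffler \<alpha> (c * (t - x) powr \<alpha>) * g x)"
    using integrable_suminf[OF \<psi> AE_I2[OF \<psi>_sum] \<psi>_int_sum] unfolding \<psi>_suminf set_integrable_def .
  have abc: "abc_derivative B \<alpha> a f t = B \<alpha> / (1 - \<alpha>) * I"
  proof -
    have "deriv f x = g x" if "x \<in> {a<..<t} - {x \<in> {a<..<t}. \<not> (?f has_real_derivative g x) (at x)}" for x
    proof (rule DERIV_imp_deriv)
      have "(?f has_real_derivative g x) (at x)" using that by blast
      then show "(f has_real_derivative g x) (at x)"
        by (rule has_field_derivative_transform_within_open[of _ _ _ "{a<..<t}"]) (use that in auto)
    qed
    then show ?thesis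
      unfolding abc_derivative_def I_def c_def[symmetric]
      by (subst set_integral_lebesgue_Ioo_eq_lborel_Icc[OF intE g(3)]) auto
  qed
  \<comment> \<open>The subtracted part is \<open>L\<close> times a Mittag-Leffler term at
    \<open>x = a\<close>; summed over \<open>k\<close> these give the E_\<alpha> term.\<close>
  have term_eq: "integral\<^sup>L lborel (\<psi> k) = c ^ k * rl_integral a (\<alpha> * real k) f t - L * ml k a" for k
  proof (cases "k = 0")
    \<comment> \<open>Here the series term is 1 and \<open>rl_integral\<close> is
      \<open>f t\<close>, so the claim is the fundamental theorem itself.\<close>
    case True
    have "integral\<^sup>L lborel (\<psi> k) = (LINT x:{a..t}|lborel. g x)"
      unfolding \<psi>_def ml_def set_lebesgue_integral_def using True by simp
    also have "\<dots> = f t - L" using FTC[of t] t by simp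
    finally show ?thesis using True by (simp add: rl_integral_def ml_def)
  next
    case False
    define \<sigma> where "\<sigma> = \<alpha> * real k"
    have "\<sigma> > 0" using False assms(3) by (simp add: \<sigma>_def)
    \<comment> \<open>At \<open>x = t\<close> this needs \<open>k > 0\<close>: the library has \<open>0 powr 0 = 0\<close>, whereas \<open>0 ^ 0 = 1\<close>.\<close>
    have pow: "((t - x) powr \<alpha>) ^ k = (t - x) powr \<sigma>" if "x \<in> {a..t}" for x
      using that False assms(3) by (cases "x = t") (simp_all add: \<sigma>_def powr_power mult.commute)
    note parts = powr_kernel_integral_by_parts[OF g(1) \<open>\<sigma> > 0\<close> less_imp_le[OF t(1)]]
    have ker: "has_bochner_integral lborel (\<lambda>s. indicator {a..t} s *\<^sub>R (\<sigma> * (t - s) powr (\<sigma> - 1))) ((t - a) powr \<sigma>)"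
      using has_bochner_integral_powr_kernel[OF \<open>\<sigma> > 0\<close> less_imp_le[OF t(1)]] by simp
    have ker_int': "set_integrable lborel {a..t} (\<lambda>s. \<sigma> * (t - s) powr (\<sigma> - 1))"
      using integrable.intros[OF ker] unfolding set_integrable_def .
    have ker_int: "set_integrable lborel {a..t} (\<lambda>s. L * (\<sigma> * (t - s) powr (\<sigma> - 1)))"
      by (rule set_integrable_mult_right) (rule ker_int')
    have ker_eq': "(LINT s:{a..t}|lborel. \<sigma> * (t - s) powr (\<sigma> - 1)) = (t - a) powr \<sigma>"
      using has_bochner_integral_integral_eq[OF ker] unfolding set_lebesgue_integral_def .
    have ker_eq: "(LINT s:{a..t}|lborel. L * (\<sigma> * (t - s) powr (\<sigma> - 1))) = L * (t - a) powr \<sigma>"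
      by (subst set_integral_mult_right) (simp only: ker_eq')
    \<comment> \<open>The primitive of \<open>g\<close> at \<open>s\<close> is
      \<open>?f s - L\<close>; the constant \<open>L\<close> contributes a multiple of the kernel
      integral, the boundary term.\<close>
    have split: "\<sigma> * (?f s * (t - s) powr (\<sigma> - 1)) =
        \<sigma> * (t - s) powr (\<sigma> - 1) * (LINT x:{a..s}|lborel. g x) + L * (\<sigma> * (t - s) powr (\<sigma> - 1))"
      if "s \<in> {a..t}" for s
      unfolding FTC[OF that] by (simp add: algebra_simps)
    \<comment> \<open>Integrability against the singular kernel is inherited from the two summands
      of \<open>split\<close>.\<close>
    have f_int: "set_integrable lborel {a..t} (\<lambda>s. \<sigma> * (?f s * (t - s) powr (\<sigma> - 1)))"
      using set_integral_add(1)[OF parts(1) ker_int] split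
      by (subst set_integrable_cong[OF refl refl]) auto
    have f_int': "set_integrable lborel {a..t} (\<lambda>s. ?f s * (t - s) powr (\<sigma> - 1))"
      using f_int \<open>\<sigma> > 0\<close> by (simp add: set_integrable_mult_right_iff)
    have "(LINT s:{a..t}|lborel. \<sigma> * (?f s * (t - s) powr (\<sigma> - 1))) =
        (LINT x:{a..t}|lborel. (t - x) powr \<sigma> * g x) + L * (t - a) powr \<sigma>"
      unfolding parts(2) ker_eq[symmetric] set_integral_add(2)[OF parts(1) ker_int, symmetric]
      using split by (intro set_lebesgue_integral_cong) auto
    moreover have "rl_integral a \<sigma> f t = 1 / Gamma \<sigma> * (LINT s:{a..t}|lborel. ?f s * (t - s) powr (\<sigma> - 1))"
      unfolding rl_integral_def using \<open>\<sigma> > 0\<close>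
      by (subst set_integral_lebesgue_Ioo_eq_lborel_Icc[OF f_int' negligible_empty]) auto
    ultimately have "(LINT x:{a..t}|lborel. (t - x) powr \<sigma> * g x) =
        \<sigma> * Gamma \<sigma> * rl_integral a \<sigma> f t - L * (t - a) powr \<sigma>"
      using \<open>\<sigma> > 0\<close> less_imp_neq[OF Gamma_real_pos[OF \<open>\<sigma> > 0\<close>]] by simp
    \<comment> \<open>Lets the Gamma factor of the series coefficient cancel against the \<sigma> of
      the kernel and the normalization of \<open>rl_integral\<close>.\<close>
    moreover have "\<sigma> * Gamma \<sigma> = Gamma (\<sigma> + 1)"
      using Gamma_plus1[of \<sigma>] \<open>\<sigma> > 0\<close> by (auto simp: nonpos_Ints_def)
    moreover have "integral\<^sup>L lborel (\<psi> k) = c ^ k / Gamma (\<sigma> + 1) * (LINT x:{a..t}|lborel. (t - x) powr \<sigma> * g x)"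
    proof -
      have "\<psi> k = (\<lambda>x. c ^ k / Gamma (\<sigma> + 1) * (indicator {a..t} x *\<^sub>R ((t - x) powr \<sigma> * g x)))"
        using pow by (auto simp: fun_eq_iff \<psi>_def ml_def \<sigma>_def indicator_def power_mult_distrib)
      then show ?thesis unfolding set_lebesgue_integral_def by simp
    qed
    moreover have "Gamma (\<sigma> + 1) \<noteq> 0"
      using Gamma_real_pos[of "\<sigma> + 1"] \<open>\<sigma> > 0\<close> by linarith
    ultimately show ?thesis
      using pow[of a] t by (simp add: ml_def \<sigma>_def[symmetric] power_mult_distrib right_diff_distrib)
  qed
  have "(\<lambda>k. ml k a) sums mittag_leffler \<alpha> (c * (t - a) powr \<alpha>)"
    unfolding E by (rule summable_sums[OF summable_norm_cancel[OF suml]])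
  \<comment> \<open>Adding the boundary terms back writes the Riemann-Liouville series as a sum of
    two convergent series, so its summability is obtained together with its value.\<close>
  then have "(\<lambda>k. integral\<^sup>L lborel (\<psi> k) + L * ml k a) sums (I + L * mittag_leffler \<alpha> (c * (t - a) powr \<alpha>))"
    by (intro sums_add sums_I sums_mult)
  then have sums: "(\<lambda>k. c ^ k * rl_integral a (\<alpha> * real k) f t) sums (I + L * mittag_leffler \<alpha> (c * (t - a) powr \<alpha>))"
    by (simp add: term_eq)
  have "c * (t - a) powr \<alpha> = - (\<alpha> * (t - a) powr \<alpha> / (1 - \<alpha>))"
    by (simp add: c_def)
  with sums show "summable (\<lambda>k. (- (\<alpha> / (1 - \<alpha>))) ^ k * rl_integral a (\<alpha> * real k) f t) \<and>
     abc_derivative B \<alpha> a f t =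
       - (B \<alpha> * Lim (at_right a) f / (1 - \<alpha>)) *
           mittag_leffler \<alpha> (- (\<alpha> * (t - a) powr \<alpha> / (1 - \<alpha>)))
       + B \<alpha> / (1 - \<alpha>) *
           (\<Sum>k. (- (\<alpha> / (1 - \<alpha>))) ^ k * rl_integral a (\<alpha> * real k) f t)"
    unfolding c_def[symmetric] L_def[symmetric] abc
    by (auto simp: sums_iff algebra_simps add_divide_distrib)
qed

end
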